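(* Let $\mathbf{P}$ be a property that a deformation of $\overline\rho$ may or may not satisfy, which depends only on the equivalence class of the representation and which $\overline\rho$ satisfies. Let $\rho^{\mathrm{univ}}:G_K\to\mathrm{GL}_2(R^{\mathrm{univ}})$ be a deformation of $\overline\rho$ universal for $\mathbf{P}$: for every deformation $\rho:G_K\to\mathrm{GL}_2(R)$ having $\mathbf{P}$ there is a unique morphism $\phi:R^{\mathrm{univ}}\to R$ with $\rho=\phi\circ\rho^{\mathrm{univ}}$. Suppose that $\rho^{\mathrm{univ}}=\mathrm{Ind}_{G_L}^{G_K}(\chi)$ for a character $\chi:G_L\to(R^{\mathrm{univ}})^\times$ lifting $\overline\chi$, and that $\rho^{\mathrm{univ}}$ is unramified above $p$. Let $\mathfrak n$ be an ideal of $\mathcal{O}_K$ coprime to $p$, $\mathbb{T}_{\mathrm{dih}}$ a quotient of $\mathbb{T}_{1,\mathfrak n}$ which is a complete Noetherian local $W(\mathbb{F})$-algebra with residue field $\mathbb{F}$, $\rho_{\mathrm{dih}}:G_K\to\mathrm{GL}_2(\mathbb{T}_{\mathrm{dih}})$ a deformation of $\overline\rho$ with $\mathrm{tr}(\rho_{\mathrm{dih}}(\mathrm{Frob}_{\mathfrak q}))=T_{\mathfrak q}$ for all primes $\mathfrak q\nmid p\mathfrak n$, and $\psi:\mathbb{T}_{\mathrm{dih}}\to R^{\mathrm{univ}}$ a ring homomorphism with $\psi\circ\rho_{\mathrm{dih}}=\rho^{\mathrm{univ}}$ (such data exist for $\rho^{\mathrm{univ}}$). Suppose further that $\rho_{\mathrm{dih}}$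 also satisfies $\mathbf{P}$. Then $R^{\mathrm{univ}}\cong\mathbb{T}_{\mathrm{dih}}$.
   Context: Let $p$ be a prime, $\mathbb{F}$ a finite field of characteristic $p$, $W(\mathbb{F})$ its Witt vectors, $\mathcal{C}$ the category of complete local Noetherian $W(\mathbb{F})$-algebras with residue field $\mathbb{F}$; deformations are continuous lifts to $\mathrm{GL}_2$ of rings in $\mathcal{C}$. Let $K$ be a totally real number field, $L$ a quadratic extension, $\overline\chi:G_L\to\mathbb{F}^\times$ a character with $\overline\rho=\mathrm{Ind}_{G_L}^{G_K}(\overline\chi):G_K\to\mathrm{GL}_2(\mathbb{F})$ absolutely irreducible and totally odd. Fix $\mathbb{C}\cong\overline{\mathbb{Q}}_p$; $\mathbb{T}_{1,\mathfrak n}$ is the $W(\mathbb{F})$-algebra generated by the Hecke operators $T_{\mathfrak q}$, $\mathfrak q\nmid\mathfrak np$ prime, acting faithfully on the space $S_1(\Gamma_1(\mathfrak n),\overline{\mathbb{Q}}_p)$ of cuspidal Hilbert modular forms over $K$ of parallel weight one and level $\Gamma_1(\mathfrak n)$. *)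

theory Defs
  imports
    "HOL-Analysis.Analysis"
    "HOL-Library.Poly_Mapping"
    "HOL-Algebra.Algebra"
    "HOL-Algebra.Algebraic_Closure_Type"
begin

section \<open>Witt vectors\<close>

type_synonym witt_poly = "((nat + nat) \<Rightarrow>\<^sub>0 nat) \<Rightarrow>\<^sub>0 int"

text \<open>
  Integral polynomials in the two families of variables \<open>X\<^sub>i\<close> (index \<open>Inl i\<close>) and
  \<open>Y\<^sub>i\<close> (index \<open>Inr i\<close>).
\<close>

definition poly_var :: "nat + nat \<Rightarrow> witt_poly" where
  "poly_var v = Poly_Mapping.single (Poly_Mapping.single v 1) 1"

definition ghost :: "nat \<Rightarrow> (nat \<Rightarrow> witt_poly) \<Rightarrow> nat \<Rightarrow> witt_poly" where
  "ghost p Z n = (\<Sum>i\<le>n. of_nat (p ^ i) * Z i ^ (p ^ (n - i)))"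

text \<open>
  The sequences of polynomials defining the sum and the product of Witt vectors: by Witt's
  theorem there is exactly one sequence over the integers with the given ghost components.
\<close>

definition witt_sum :: "nat \<Rightarrow> nat \<Rightarrow> witt_poly" where
  "witt_sum p = (THE S. \<forall>n. ghost p S n =
     ghost p (\<lambda>i. poly_var (Inl i)) n + ghost p (\<lambda>i. poly_var (Inr i)) n)"

definition witt_prod :: "nat \<Rightarrow> nat \<Rightarrow> witt_poly" where
  "witt_prod p = (THE S. \<forall>n. ghost p S n =
     ghost p (\<lambda>i. poly_var (Inl i)) n * ghost p (\<lambda>i. poly_var (Inr i)) n)"

definition eval_poly :: "('a, 'b) ring_scheme \<Rightarrow> (nat + nat \<Rightarrow> 'a) \<Rightarrow> witt_poly \<Rightarrow> 'a" where
  "eval_poly A x f =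
     (\<Oplus>\<^bsub>A\<^esub>m\<in>Poly_Mapping.keys f.
        [Poly_Mapping.lookup f m] \<cdot>\<^bsub>A\<^esub>
          (\<Otimes>\<^bsub>A\<^esub>v\<in>Poly_Mapping.keys m. x v [^]\<^bsub>A\<^esub> Poly_Mapping.lookup m v))"

definition Witt :: "nat \<Rightarrow> ('a, 'b) ring_scheme \<Rightarrow> (nat \<Rightarrow> 'a) ring" where
  "Witt p A = \<lparr> carrier = {a. \<forall>n. a n \<in> carrier A},
     monoid.mult = (\<lambda>a b n. eval_poly A (case_sum a b) (witt_prod p n)),
     one = (\<lambda>n. if n = 0 then \<one>\<^bsub>A\<^esub> else \<zero>\<^bsub>A\<^esub>),
     ring.zero = (\<lambda>n. \<zero>\<^bsub>A\<^esub>),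
     add = (\<lambda>a b n. eval_poly A (case_sum a b) (witt_sum p n)) \<rparr>"

section \<open>Coefficient rings\<close>

text \<open>
  A ring together with a structure map from \<open>W(F)\<close> and a reduction map to \<open>F\<close>. The residue
  field and all coefficient rings have their carriers in one type, which serves as the universe
  over which the universal property of a deformation ranges.
\<close>

record 'a calg = "'a ring" +
  str :: "(nat \<Rightarrow> 'a) \<Rightarrow> 'a"
  red :: "'a \<Rightarrow> 'a"

definition max_ideal :: "'a ring \<Rightarrow> 'a calg \<Rightarrow> 'a set" where
  "max_ideal F R = a_kernel R F (red R)"

definition max_ideal_pow :: "'a ring \<Rightarrow> 'a calg \<Rightarrow> nat \<Rightarrow> 'a set" where
  "max_ideal_pow F R n = max_ideal F R [^]\<^bsub>ideals_set R\<^esub> n"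

definition adically_complete :: "'a ring \<Rightarrow> 'a calg \<Rightarrow> bool" where
  "adically_complete F R \<longleftrightarrow>
     (\<Inter>n. max_ideal_pow F R n) = {\<zero>\<^bsub>R\<^esub>} \<and>
     (\<forall>x. (\<forall>n. x n \<in> carrier R \<and> x (Suc n) \<ominus>\<^bsub>R\<^esub> x n \<in> max_ideal_pow F R n) \<longrightarrow>
        (\<exists>y\<in>carrier R. \<forall>n. y \<ominus>\<^bsub>R\<^esub> x n \<in> max_ideal_pow F R n))"

text \<open>
  Complete local Noetherian \<open>W(F)\<close>-algebras with residue field \<open>F\<close>. The last condition says
  that the identification of the residue field with \<open>F\<close> is the one induced by the
  algebra structure, \<open>w 0\<close> being the reduction of \<open>w\<close> modulo \<open>p\<close>.
\<close>

definition coeff_ring :: "nat \<Rightarrow> 'a ring \<Rightarrow> 'a calg \<Rightarrow> bool" where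
  "coeff_ring p F R \<longleftrightarrow>
     cring R \<and> noetherian_ring R \<and> (\<exists>!I. maximalideal I R) \<and>
     red R \<in> ring_hom R F \<and> red R ` carrier R = carrier F \<and>
     adically_complete F R \<and>
     str R \<in> ring_hom (Witt p F) R \<and>
     (\<forall>w\<in>carrier (Witt p F). red R (str R w) = w 0)"

definition residue_calg :: "'a ring \<Rightarrow> 'a calg" where
  "residue_calg F = ring.extend F \<lparr> str = (\<lambda>w. w 0), red = (\<lambda>x. x) \<rparr>"

definition calg_hom :: "nat \<Rightarrow> 'a ring \<Rightarrow> 'a calg \<Rightarrow> 'a calg \<Rightarrow> ('a \<Rightarrow> 'a) set" where
  "calg_hom p F R S = {\<phi> \<in> ring_hom R S \<inter> extensional (carrier R).
     (\<forall>w\<in>carrier (Witt p F). \<phi> (str R w) = str S w) \<and>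
     \<phi> ` max_ideal F R \<subseteq> max_ideal F S}"

definition calg_iso :: "nat \<Rightarrow> 'a ring \<Rightarrow> 'a calg \<Rightarrow> 'a calg \<Rightarrow> bool" where
  "calg_iso p F R S \<longleftrightarrow> (\<exists>\<phi>\<in>calg_hom p F R S. bij_betw \<phi> (carrier R) (carrier S))"

definition adic_topology :: "'a ring \<Rightarrow> 'a calg \<Rightarrow> 'a topology" where
  "adic_topology F R = topology_generated_by (\<Union>n. a_rcosets\<^bsub>R\<^esub> (max_ideal_pow F R n))"

section \<open>Two by two matrices over a ring\<close>

datatype 'a mat2 = Mat2 (m11: 'a) (m12: 'a) (m21: 'a) (m22: 'a)

definition det2 :: "('a, 'b) ring_scheme \<Rightarrow> 'a mat2 \<Rightarrow> 'a" where
  "det2 R A = (m11 A \<otimes>\<^bsub>R\<^esub> m22 A) \<ominus>\<^bsub>R\<^esub> (m12 A \<otimes>\<^bsub>R\<^esub> m21 A)"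

definition tr2 :: "('a, 'b) ring_scheme \<Rightarrow> 'a mat2 \<Rightarrow> 'a" where
  "tr2 R A = m11 A \<oplus>\<^bsub>R\<^esub> m22 A"

definition GL2 :: "('a, 'b) ring_scheme \<Rightarrow> 'a mat2 monoid" where
  "GL2 R = \<lparr> carrier = {A. set_mat2 A \<subseteq> carrier R \<and> det2 R A \<in> Units R},
     monoid.mult = (\<lambda>A B. Mat2
        (m11 A \<otimes>\<^bsub>R\<^esub> m11 B \<oplus>\<^bsub>R\<^esub> m12 A \<otimes>\<^bsub>R\<^esub> m21 B) (m11 A \<otimes>\<^bsub>R\<^esub> m12 B \<oplus>\<^bsub>R\<^esub> m12 A \<otimes>\<^bsub>R\<^esub> m22 B)
        (m21 A \<otimes>\<^bsub>R\<^esub> m11 B \<oplus>\<^bsub>R\<^esub> m22 A \<otimes>\<^bsub>R\<^esub> m21 B) (m21 A \<otimes>\<^bsub>R\<^esub> m12 B \<oplus>\<^bsub>R\<^esub> m22 A \<otimes>\<^bsub>R\<^esub> m22 B)),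
     one = Mat2 \<one>\<^bsub>R\<^esub> \<zero>\<^bsub>R\<^esub> \<zero>\<^bsub>R\<^esub> \<one>\<^bsub>R\<^esub> \<rparr>"

definition mat2_apply :: "('a, 'b) ring_scheme \<Rightarrow> 'a mat2 \<Rightarrow> 'a \<times> 'a \<Rightarrow> 'a \<times> 'a" where
  "mat2_apply R A v = (m11 A \<otimes>\<^bsub>R\<^esub> fst v \<oplus>\<^bsub>R\<^esub> m12 A \<otimes>\<^bsub>R\<^esub> snd v,
                       m21 A \<otimes>\<^bsub>R\<^esub> fst v \<oplus>\<^bsub>R\<^esub> m22 A \<otimes>\<^bsub>R\<^esub> snd v)"

definition plane_subspace :: "('a, 'b) ring_scheme \<Rightarrow> ('a \<times> 'a) set \<Rightarrow> bool" where
  "plane_subspace k V \<longleftrightarrow> V \<subseteq> carrier k \<times> carrier k \<and> (\<zero>\<^bsub>k\<^esub>, \<zero>\<^bsub>k\<^esub>) \<in> V \<and>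
     (\<forall>v\<in>V. \<forall>w\<in>V. (fst v \<oplus>\<^bsub>k\<^esub> fst w, snd v \<oplus>\<^bsub>k\<^esub> snd w) \<in> V) \<and>
     (\<forall>c\<in>carrier k. \<forall>v\<in>V. (c \<otimes>\<^bsub>k\<^esub> fst v, c \<otimes>\<^bsub>k\<^esub> snd v) \<in> V)"

definition irreducible_rep :: "'g set \<Rightarrow> ('a, 'b) ring_scheme \<Rightarrow> ('g \<Rightarrow> 'a mat2) \<Rightarrow> bool" where
  "irreducible_rep G k \<rho> \<longleftrightarrow>
     (\<forall>V. plane_subspace k V \<and> (\<forall>g\<in>G. mat2_apply k (\<rho> g) ` V \<subseteq> V) \<longrightarrow>
        V = {(\<zero>\<^bsub>k\<^esub>, \<zero>\<^bsub>k\<^esub>)} \<or> V = carrier k \<times> carrier k)"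

definition absolutely_irreducible_rep :: "'g set \<Rightarrow> 'a ring \<Rightarrow> ('g \<Rightarrow> 'a mat2) \<Rightarrow> bool" where
  "absolutely_irreducible_rep G F \<rho> \<longleftrightarrow>
     irreducible_rep G (field.alg_closure F) (\<lambda>g. map_mat2 (ring.indexed_const F) (\<rho> g))"

section \<open>Number fields and their Galois groups\<close>

text \<open>Number fields are subfields of the complex numbers.\<close>

abbreviation CC :: "complex ring" where
  "CC \<equiv> ring_of_type_algebra"

definition number_field :: "complex set \<Rightarrow> bool" where
  "number_field K \<longleftrightarrow> subfield K CC \<and> ring.finite_dimension CC \<rat> K"

definition quadratic_extension :: "complex set \<Rightarrow> complex set \<Rightarrow> bool" where
  "quadratic_extension K L \<longleftrightarrow> K \<subseteq> L \<and> subfield L CC \<and> ring.dimension CC 2 K L"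

definition embeddings :: "complex set \<Rightarrow> (complex \<Rightarrow> complex) set" where
  "embeddings K = ring_hom (CC\<lparr>carrier := K\<rparr>) CC \<inter> extensional K"

definition totally_real :: "complex set \<Rightarrow> bool" where
  "totally_real K \<longleftrightarrow> (\<forall>\<sigma>\<in>embeddings K. \<sigma> ` K \<subseteq> \<real>)"

definition totally_positive :: "complex set \<Rightarrow> complex set" where
  "totally_positive K = {x\<in>K. \<forall>\<sigma>\<in>embeddings K. \<sigma> x \<in> \<real> \<and> Re (\<sigma> x) > 0}"

definition Int_ring :: "complex set \<Rightarrow> complex ring" where
  "Int_ring K = CC\<lparr>carrier := {x\<in>K. algebraic_int x}\<rparr>"

definition Qbar :: "complex set" where
  "Qbar = {x. algebraic x}"

definition primes_of :: "complex set \<Rightarrow> complex set set" where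
  "primes_of K = {\<qq>. primeideal \<qq> (Int_ring K) \<and> \<qq> \<noteq> {0}}"

definition ideal_norm :: "complex set \<Rightarrow> complex set \<Rightarrow> nat" where
  "ideal_norm K \<qq> = card (a_rcosets\<^bsub>Int_ring K\<^esub> \<qq>)"

text \<open>
  The automorphisms of \<open>Qbar\<close> over \<open>K\<close>, extended by the identity to all complex numbers.
\<close>

definition Gal :: "complex set \<Rightarrow> (complex \<Rightarrow> complex) monoid" where
  "Gal K = \<lparr> carrier = {\<sigma>. \<sigma> \<in> ring_iso (CC\<lparr>carrier := Qbar\<rparr>) (CC\<lparr>carrier := Qbar\<rparr>) \<and>
                          (\<forall>x\<in>K. \<sigma> x = x) \<and> (\<forall>x. x \<notin> Qbar \<longrightarrow> \<sigma> x = x)},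
     monoid.mult = (\<circ>), one = id \<rparr>"

text \<open>The Krull topology is the topology of pointwise convergence on discrete \<open>Qbar\<close>.\<close>

definition krull_topology :: "complex set \<Rightarrow> (complex \<Rightarrow> complex) topology" where
  "krull_topology K =
     subtopology (product_topology (\<lambda>_. discrete_topology UNIV) UNIV) (carrier (Gal K))"

definition complex_conjugations :: "(complex \<Rightarrow> complex) set" where
  "complex_conjugations =
     {inv\<^bsub>Gal \<rat>\<^esub> \<sigma> \<circ> (\<lambda>x. if x \<in> Qbar then cnj x else x) \<circ> \<sigma> |\<sigma>. \<sigma> \<in> carrier (Gal \<rat>)}"

definition inertia :: "complex set \<Rightarrow> complex set \<Rightarrow> (complex \<Rightarrow> complex) set" where
  "inertia K \<PP> = {\<sigma>\<in>carrier (Gal K). \<forall>x\<in>carrier (Int_ring Qbar). \<sigma> x - x \<in> \<PP>}"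

text \<open>All arithmetic Frobenius elements at \<open>\<qq>\<close>, for all primes of \<open>Qbar\<close> above \<open>\<qq>\<close>.\<close>

definition Frob :: "complex set \<Rightarrow> complex set \<Rightarrow> (complex \<Rightarrow> complex) set" where
  "Frob K \<qq> = {\<sigma>\<in>carrier (Gal K). \<exists>\<PP>. primeideal \<PP> (Int_ring Qbar) \<and> \<PP> \<inter> K = \<qq> \<and>
     (\<forall>x\<in>carrier (Int_ring Qbar). \<sigma> x - x ^ ideal_norm K \<qq> \<in> \<PP>)}"

section \<open>Galois representations and deformations\<close>

definition galois_character ::
    "complex set \<Rightarrow> 'a ring \<Rightarrow> 'a calg \<Rightarrow> ((complex \<Rightarrow> complex) \<Rightarrow> 'a) \<Rightarrow> bool" where
  "galois_character L F R chi \<longleftrightarrow>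
     chi \<in> hom (Gal L) (units_of R) \<and> continuous_map (krull_topology L) (adic_topology F R) chi"

definition galois_rep ::
    "complex set \<Rightarrow> 'a ring \<Rightarrow> 'a calg \<Rightarrow> ((complex \<Rightarrow> complex) \<Rightarrow> 'a mat2) \<Rightarrow> bool" where
  "galois_rep K F R \<rho> \<longleftrightarrow>
     \<rho> \<in> hom (Gal K) (GL2 R) \<and>
     (\<forall>e\<in>{m11, m12, m21, m22}.
        continuous_map (krull_topology K) (adic_topology F R) (\<lambda>g. e (\<rho> g)))"

text \<open>
  The representation of \<open>Gal K\<close> induced from the character \<open>chi\<close> of the subgroup \<open>Gal L\<close> of
  index two, in the basis \<open>1 \<otimes> 1, \<tau> \<otimes> 1\<close>, where \<open>\<tau>\<close> represents the non-trivial coset.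
\<close>

definition induced_rep ::
    "complex set \<Rightarrow> complex set \<Rightarrow> (complex \<Rightarrow> complex) \<Rightarrow> 'a calg \<Rightarrow>
     ((complex \<Rightarrow> complex) \<Rightarrow> 'a) \<Rightarrow> (complex \<Rightarrow> complex) \<Rightarrow> 'a mat2" where
  "induced_rep K L \<tau> R chi g =
     (let \<tau>' = inv\<^bsub>Gal K\<^esub> \<tau>; chi0 = (\<lambda>h. if h \<in> carrier (Gal L) then chi h else \<zero>\<^bsub>R\<^esub>)
      in Mat2 (chi0 g) (chi0 (g \<circ> \<tau>)) (chi0 (\<tau>' \<circ> g)) (chi0 (\<tau>' \<circ> g \<circ> \<tau>)))"

definition totally_odd ::
    "complex set \<Rightarrow> 'a ring \<Rightarrow> ((complex \<Rightarrow> complex) \<Rightarrow> 'a mat2) \<Rightarrow> bool" where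
  "totally_odd K F \<rho> \<longleftrightarrow>
     (\<forall>c\<in>complex_conjugations \<inter> carrier (Gal K). det2 F (\<rho> c) = \<ominus>\<^bsub>F\<^esub> \<one>\<^bsub>F\<^esub>)"

definition unramified_above ::
    "complex set \<Rightarrow> nat \<Rightarrow> 'a calg \<Rightarrow> ((complex \<Rightarrow> complex) \<Rightarrow> 'a mat2) \<Rightarrow> bool" where
  "unramified_above K p R \<rho> \<longleftrightarrow>
     (\<forall>\<PP>. primeideal \<PP> (Int_ring Qbar) \<and> of_nat p \<in> \<PP> \<longrightarrow>
        (\<forall>\<sigma>\<in>inertia K \<PP>. \<rho> \<sigma> = \<one>\<^bsub>GL2 R\<^esub>))"

definition deformation ::
    "complex set \<Rightarrow> 'a ring \<Rightarrow> ((complex \<Rightarrow> complex) \<Rightarrow> 'a mat2) \<Rightarrow>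
     'a calg \<Rightarrow> ((complex \<Rightarrow> complex) \<Rightarrow> 'a mat2) \<Rightarrow> bool" where
  "deformation K F \<rho>bar R \<rho> \<longleftrightarrow>
     galois_rep K F R \<rho> \<and> (\<forall>g\<in>carrier (Gal K). map_mat2 (red R) (\<rho> g) = \<rho>bar g)"

text \<open>Conjugacy by a matrix that reduces to the identity: equality of deformations.\<close>

definition strictly_equivalent ::
    "complex set \<Rightarrow> 'a ring \<Rightarrow> 'a calg \<Rightarrow> ((complex \<Rightarrow> complex) \<Rightarrow> 'a mat2) \<Rightarrow>
     ((complex \<Rightarrow> complex) \<Rightarrow> 'a mat2) \<Rightarrow> bool" where
  "strictly_equivalent K F R \<rho> \<rho>' \<longleftrightarrow>
     (\<exists>U\<in>carrier (GL2 R). map_mat2 (red R) U = \<one>\<^bsub>GL2 F\<^esub> \<and>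
        (\<forall>g\<in>carrier (Gal K). \<rho>' g = U \<otimes>\<^bsub>GL2 R\<^esub> \<rho> g \<otimes>\<^bsub>GL2 R\<^esub> inv\<^bsub>GL2 R\<^esub> U))"

definition deformation_property ::
    "nat \<Rightarrow> 'a ring \<Rightarrow> complex set \<Rightarrow> ((complex \<Rightarrow> complex) \<Rightarrow> 'a mat2) \<Rightarrow>
     ('a calg \<Rightarrow> ((complex \<Rightarrow> complex) \<Rightarrow> 'a mat2) \<Rightarrow> bool) \<Rightarrow> bool" where
  "deformation_property p F K \<rho>bar P \<longleftrightarrow>
     (\<forall>R \<rho> \<rho>'. coeff_ring p F R \<and> deformation K F \<rho>bar R \<rho> \<and> deformation K F \<rho>bar R \<rho>' \<and>
        strictly_equivalent K F R \<rho> \<rho>' \<longrightarrow> P R \<rho> = P R \<rho>') \<and>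
     P (residue_calg F) \<rho>bar"

definition universal_deformation ::
    "nat \<Rightarrow> 'a ring \<Rightarrow> complex set \<Rightarrow> ((complex \<Rightarrow> complex) \<Rightarrow> 'a mat2) \<Rightarrow>
     ('a calg \<Rightarrow> ((complex \<Rightarrow> complex) \<Rightarrow> 'a mat2) \<Rightarrow> bool) \<Rightarrow>
     'a calg \<Rightarrow> ((complex \<Rightarrow> complex) \<Rightarrow> 'a mat2) \<Rightarrow> bool" where
  "universal_deformation p F K \<rho>bar P Runiv \<rho>univ \<longleftrightarrow>
     coeff_ring p F Runiv \<and> deformation K F \<rho>bar Runiv \<rho>univ \<and> P Runiv \<rho>univ \<and>
     (\<forall>R \<rho>. coeff_ring p F R \<and> deformation K F \<rho>bar R \<rho> \<and> P R \<rho> \<longrightarrow>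
        (\<exists>!\<phi>. \<phi> \<in> calg_hom p F Runiv R \<and>
              strictly_equivalent K F R (\<lambda>g. map_mat2 \<phi> (\<rho>univ g)) \<rho>))"

section \<open>Hilbert modular forms\<close>

text \<open>
  Hilbert modular forms over \<open>K\<close> of level \<open>\<Gamma>\<^sub>1(\<nn>)\<close> are functions of pairs \<open>(\<Lambda>, t)\<close>, where
  \<open>\<Lambda>\<close> is an \<open>O\<^sub>K\<close>-lattice in \<open>K \<otimes> \<complex>\<close>, the product of copies of the complex numbers indexed by
  the embeddings of \<open>K\<close>, and \<open>t\<close> is a point of exact order \<open>\<nn>\<close> modulo \<open>\<Lambda>\<close>. Modulo
  homotheties these pairs are the points of
  \<open>GL\<^sub>2(K)\<^sup>+ \ (H\<^sup>d \<times> GL\<^sub>2(A\<^sub>f) / U\<^sub>1(\<nn>))\<close>, with \<open>A\<^sub>f\<close> the finite adeles, \<open>U\<^sub>1(\<nn>)\<close> the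
  matrices whose second row is \<open>(0, 1)\<close> modulo \<open>\<nn>\<close> and \<open>d\<close> the degree of \<open>K\<close>, so all
  narrow ideal classes are covered at once.
\<close>

type_synonym cvec = "(complex \<Rightarrow> complex) \<Rightarrow> complex"
type_synonym form = "cvec set \<Rightarrow> cvec \<Rightarrow> complex"

definition vadd :: "complex set \<Rightarrow> cvec \<Rightarrow> cvec \<Rightarrow> cvec" where
  "vadd K u v = (\<lambda>\<sigma>\<in>embeddings K. u \<sigma> + v \<sigma>)"

definition vmult :: "complex set \<Rightarrow> cvec \<Rightarrow> cvec \<Rightarrow> cvec" where
  "vmult K c u = (\<lambda>\<sigma>\<in>embeddings K. c \<sigma> * u \<sigma>)"

abbreviation (input) emb :: "complex \<Rightarrow> cvec" where
  "emb a \<equiv> (\<lambda>\<sigma>. \<sigma> a)"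

definition lattice_in_plane :: "complex set \<Rightarrow> (complex \<times> complex) set \<Rightarrow> bool" where
  "lattice_in_plane K M \<longleftrightarrow>
     (\<exists>S. finite S \<and> S \<subseteq> K \<times> K \<and>
        M = {(\<Sum>s\<in>S. c s * fst s, \<Sum>s\<in>S. c s * snd s) |c. c ` S \<subseteq> carrier (Int_ring K)}) \<and>
     (\<exists>u\<in>M. \<exists>v\<in>M. fst u * snd v \<noteq> snd u * fst v)"

definition combine :: "complex set \<Rightarrow> cvec \<Rightarrow> cvec \<Rightarrow> complex \<times> complex \<Rightarrow> cvec" where
  "combine K \<omega>1 \<omega>2 m = vadd K (vmult K (emb (fst m)) \<omega>1) (vmult K (emb (snd m)) \<omega>2)"

definition OK_lattice :: "complex set \<Rightarrow> cvec set \<Rightarrow> bool" where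
  "OK_lattice K \<Lambda> \<longleftrightarrow>
     (\<exists>M \<omega>1 \<omega>2. lattice_in_plane K M \<and>
        (\<forall>\<sigma>\<in>embeddings K. Im (\<omega>1 \<sigma> * cnj (\<omega>2 \<sigma>)) \<noteq> 0) \<and> \<Lambda> = combine K \<omega>1 \<omega>2 ` M)"

definition level_pair :: "complex set \<Rightarrow> complex set \<Rightarrow> cvec set \<Rightarrow> cvec \<Rightarrow> bool" where
  "level_pair K \<nn> \<Lambda> t \<longleftrightarrow> OK_lattice K \<Lambda> \<and> t \<in> extensional (embeddings K) \<and>
     {a\<in>carrier (Int_ring K). vmult K (emb a) t \<in> \<Lambda>} = \<nn>"

definition half_planes :: "complex set \<Rightarrow> cvec set" where
  "half_planes K = PiE (embeddings K) (\<lambda>_. {z. Im z > 0})"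

text \<open>Complex differentiability at every point of the product of upper half planes.\<close>

definition holomorphic_on_half_planes :: "complex set \<Rightarrow> (cvec \<Rightarrow> complex) \<Rightarrow> bool" where
  "holomorphic_on_half_planes K f \<longleftrightarrow>
     (\<forall>z\<in>half_planes K. \<exists>D. \<forall>\<epsilon>>0. \<exists>\<delta>>0. \<forall>w\<in>half_planes K.
        (\<forall>\<sigma>\<in>embeddings K. cmod (w \<sigma> - z \<sigma>) < \<delta>) \<longrightarrow>
        cmod (f w - f z - (\<Sum>\<sigma>\<in>embeddings K. D \<sigma> * (w \<sigma> - z \<sigma>)))
          \<le> \<epsilon> * (\<Sum>\<sigma>\<in>embeddings K. cmod (w \<sigma> - z \<sigma>)))"

text \<open>
  The Fourier expansion of a holomorphic form runs over \<open>0\<close> and the totally positive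
  elements; for a cusp form the coefficient at \<open>0\<close> vanishes. Letting \<open>M\<close> range over all
  lattices in the plane \<open>K\<^sup>2\<close>, hence over all translates of one lattice by \<open>GL\<^sub>2(K)\<close>,
  imposes this at all cusps.
\<close>

definition cuspidal_at_infinity :: "complex set \<Rightarrow> (cvec \<Rightarrow> complex) \<Rightarrow> bool" where
  "cuspidal_at_infinity K f \<longleftrightarrow>
     (\<exists>a. \<forall>z\<in>half_planes K.
        ((\<lambda>\<xi>. a \<xi> * exp (2 * of_real pi * \<i> * (\<Sum>\<sigma>\<in>embeddings K. \<sigma> \<xi> * z \<sigma>))) has_sum f z)
          (totally_positive K))"

text \<open>
  Cusp forms of parallel weight \<open>k\<close>. For \<open>m\<close> in the plane, \<open>combine K z (\<lambda>_. 1) m\<close> is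
  \<open>fst m * z + snd m\<close>.
\<close>

definition cusp_forms :: "complex set \<Rightarrow> nat \<Rightarrow> complex set \<Rightarrow> form set" where
  "cusp_forms K k \<nn> = {f.
     (\<forall>\<Lambda> t. \<not> level_pair K \<nn> \<Lambda> t \<longrightarrow> f \<Lambda> t = 0) \<and>
     (\<forall>\<Lambda> t l. level_pair K \<nn> \<Lambda> t \<and> l \<in> \<Lambda> \<longrightarrow> f \<Lambda> (vadd K t l) = f \<Lambda> t) \<and>
     (\<forall>\<Lambda> t c. level_pair K \<nn> \<Lambda> t \<and> (\<forall>\<sigma>\<in>embeddings K. c \<sigma> \<noteq> 0) \<longrightarrow>
        f (vmult K c ` \<Lambda>) (vmult K c t) = inverse ((\<Prod>\<sigma>\<in>embeddings K. c \<sigma>) ^ k) * f \<Lambda> t) \<and>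
     (\<forall>M. \<forall>m\<in>K \<times> K. lattice_in_plane K M \<longrightarrow>
        (let g = (\<lambda>z. f (combine K z (\<lambda>_. 1) ` M) (combine K z (\<lambda>_. 1) m))
         in holomorphic_on_half_planes K g \<and> cuspidal_at_infinity K g))}"

section \<open>Hecke operators\<close>

text \<open>The lattices containing \<open>\<Lambda>\<close> with quotient isomorphic to \<open>O\<^sub>K / \<qq>\<close>.\<close>

definition superlattices :: "complex set \<Rightarrow> complex set \<Rightarrow> cvec set \<Rightarrow> cvec set set" where
  "superlattices K \<qq> \<Lambda> = {\<Lambda>'. OK_lattice K \<Lambda>' \<and> \<Lambda> \<subseteq> \<Lambda>' \<and>
     (\<forall>a\<in>\<qq>. \<forall>u\<in>\<Lambda>'. vmult K (emb a) u \<in> \<Lambda>) \<and>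
     card ((\<lambda>u. vadd K u ` \<Lambda>) ` \<Lambda>') = ideal_norm K \<qq>}"

text \<open>
  The normalisation for which the eigenvalue on a normalised eigenform is its Fourier
  coefficient at \<open>\<qq>\<close>. For rational \<open>K\<close> and \<open>\<qq>\<close> generated by the prime \<open>l\<close>, the lattices containing
  \<open>\<int>z + \<int>\<close> give the usual
  \<open>(T\<^sub>l f)(z) = (\<Sum>j<l. f((z + j) / l)) / l + l\<^sup>k\<^sup>-\<^sup>1 (\<langle>l\<rangle> f)(l z)\<close>.
\<close>

definition hecke_op :: "complex set \<Rightarrow> nat \<Rightarrow> complex set \<Rightarrow> complex set \<Rightarrow> form \<Rightarrow> form" where
  "hecke_op K k \<nn> \<qq> = (\<lambda>f\<in>cusp_forms K k \<nn>. \<lambda>\<Lambda> t.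
     if level_pair K \<nn> \<Lambda> t
     then (\<Sum>\<Lambda>'\<in>superlattices K \<qq> \<Lambda>. f \<Lambda>' t) / of_nat (ideal_norm K \<qq>) else 0)"

definition scalar_op :: "complex set \<Rightarrow> nat \<Rightarrow> complex set \<Rightarrow> complex \<Rightarrow> form \<Rightarrow> form" where
  "scalar_op K k \<nn> c = (\<lambda>f\<in>cusp_forms K k \<nn>. \<lambda>\<Lambda> t. c * f \<Lambda> t)"

definition add_op ::
    "complex set \<Rightarrow> nat \<Rightarrow> complex set \<Rightarrow> (form \<Rightarrow> form) \<Rightarrow> (form \<Rightarrow> form) \<Rightarrow> form \<Rightarrow> form" where
  "add_op K k \<nn> A B = (\<lambda>f\<in>cusp_forms K k \<nn>. \<lambda>\<Lambda> t. A f \<Lambda> t + B f \<Lambda> t)"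

definition good_primes :: "complex set \<Rightarrow> nat \<Rightarrow> complex set \<Rightarrow> complex set set" where
  "good_primes K p \<nn> = {\<qq>\<in>primes_of K. \<not> \<nn> \<subseteq> \<qq> \<and> of_nat p \<notin> \<qq>}"

text \<open>
  An isomorphism of the complex numbers with an algebraic closure of the \<open>p\<close>-adic numbers that
  contains \<open>W(F)\<close>, recorded by the resulting embedding \<open>j\<close> of \<open>W(F)\<close>: the
  complex numbers become an algebraic closure of the fraction field of \<open>W(F)\<close>, which is a
  finite extension of the \<open>p\<close>-adic numbers.
\<close>

definition padic_identification ::
    "nat \<Rightarrow> 'a ring \<Rightarrow> ((nat \<Rightarrow> 'a) \<Rightarrow> complex) \<Rightarrow> bool" where
  "padic_identification p F j \<longleftrightarrow>
     j \<in> ring_hom (Witt p F) CC \<and> inj_on j (carrier (Witt p F)) \<and>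
     algebraic_closure CC {j a / j b |a b. a \<in> carrier (Witt p F) \<and> b \<in> carrier (Witt p F)}"

inductive_set hecke_carrier ::
    "nat \<Rightarrow> 'a ring \<Rightarrow> ((nat \<Rightarrow> 'a) \<Rightarrow> complex) \<Rightarrow> complex set \<Rightarrow> nat \<Rightarrow> complex set \<Rightarrow>
     (form \<Rightarrow> form) set"
  for p F j K k \<nn> where
  scalar: "w \<in> carrier (Witt p F) \<Longrightarrow> scalar_op K k \<nn> (j w) \<in> hecke_carrier p F j K k \<nn>"
| hecke: "\<qq> \<in> good_primes K p \<nn> \<Longrightarrow> hecke_op K k \<nn> \<qq> \<in> hecke_carrier p F j K k \<nn>"
| add: "A \<in> hecke_carrier p F j K k \<nn> \<Longrightarrow> B \<in> hecke_carrier p F j K k \<nn> \<Longrightarrow>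
    add_op K k \<nn> A B \<in> hecke_carrier p F j K k \<nn>"
| mult: "A \<in> hecke_carrier p F j K k \<nn> \<Longrightarrow> B \<in> hecke_carrier p F j K k \<nn> \<Longrightarrow>
    compose (cusp_forms K k \<nn>) A B \<in> hecke_carrier p F j K k \<nn>"

definition hecke_algebra ::
    "nat \<Rightarrow> 'a ring \<Rightarrow> ((nat \<Rightarrow> 'a) \<Rightarrow> complex) \<Rightarrow> complex set \<Rightarrow> nat \<Rightarrow> complex set \<Rightarrow>
     (form \<Rightarrow> form) ring" where
  "hecke_algebra p F j K k \<nn> = \<lparr> carrier = hecke_carrier p F j K k \<nn>,
     monoid.mult = compose (cusp_forms K k \<nn>),
     one = scalar_op K k \<nn> 1,
     ring.zero = scalar_op K k \<nn> 0,
     add = add_op K k \<nn> \<rparr>"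

text \<open>A surjective homomorphism of \<open>W(F)\<close>-algebras from the Hecke algebra onto \<open>T\<close>.\<close>

definition hecke_quotient_map ::
    "nat \<Rightarrow> 'a ring \<Rightarrow> ((nat \<Rightarrow> 'a) \<Rightarrow> complex) \<Rightarrow> complex set \<Rightarrow> nat \<Rightarrow> complex set \<Rightarrow>
     'a calg \<Rightarrow> ((form \<Rightarrow> form) \<Rightarrow> 'a) \<Rightarrow> bool" where
  "hecke_quotient_map p F j K k \<nn> T \<pi> \<longleftrightarrow>
     \<pi> \<in> ring_hom (hecke_algebra p F j K k \<nn>) T \<and>
     \<pi> ` carrier (hecke_algebra p F j K k \<nn>) = carrier T \<and>
     (\<forall>w\<in>carrier (Witt p F). \<pi> (scalar_op K k \<nn> (j w)) = str T w)"

end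

theory Submission
  imports Defs
begin

text \<open>
  Universality gives \<open>\<phi> : Runiv \<rightarrow> Tdih\<close> carrying \<open>\<rho>univ\<close> to \<open>\<rho>dih\<close>. It is surjective, because its
  image contains \<open>W(F)\<close> and the traces of Frobenius elements, that is, the Hecke operators, and
  these generate \<open>Tdih\<close> as a ring. For injectivity consider \<open>\<theta> = \<psi> \<circ> \<phi>\<close>, which fixes \<open>\<rho>univ\<close> up to strict equivalence. If \<open>\<theta>\<close>
  were a morphism of \<open>W(F)\<close>-algebras it would be the identity by uniqueness. But \<open>\<psi>\<close> is only a
  ring homomorphism, so \<open>\<theta>\<close> is local (the kernel of a map to a finite field is maximal) and
  induces a possibly non-trivial automorphism of \<open>F\<close>. Some power \<open>\<theta>\<^sup>n\<close> induces the identity on \<open>F\<close>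
  and is then \<open>W(F)\<close>-linear: every Witt vector has the form \<open>u\<^sup>p + p v\<close>, so two homomorphisms
  from \<open>W(F)\<close> that agree modulo the maximal ideal agree modulo all its powers. Hence
  \<open>\<theta>\<^sup>n\<close> is the identity and \<open>\<phi>\<close> is injective.
\<close>

section \<open>Integral polynomials\<close>

lemma ring_of_type_algebra_simps [simp]:
  fixes x y :: "'b::comm_ring_1"
  shows "carrier (ring_of_type_algebra :: 'b ring) = UNIV"
    and "x \<oplus>\<^bsub>ring_of_type_algebra\<^esub> y = x + y" "\<zero>\<^bsub>ring_of_type_algebra\<^esub> = (0::'b)"
    and "x \<otimes>\<^bsub>ring_of_type_algebra\<^esub> y = x * y" "\<one>\<^bsub>ring_of_type_algebra\<^esub> = (1::'b)"
  by (simp_all add: ring_of_type_algebra_def)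

lemma ring_of_type_algebra_a_inv [simp]: "\<ominus>\<^bsub>ring_of_type_algebra\<^esub> x = - (x::'b::comm_ring_1)"
  using abelian_group.minus_equality[OF ring.is_abelian_group[OF ring_from_type_algebra], of "- x" x]
  by simp

lemma ring_of_type_algebra_nat_pow [simp]:
  "x [^]\<^bsub>ring_of_type_algebra\<^esub> (n::nat) = (x::'b::comm_ring_1) ^ n"
  by (induction n) (simp_all add: nat_pow_def mult.commute)

lemma ring_of_type_algebra_add_pow [simp]:
  fixes x :: "'b::comm_ring_1" and n :: nat
  shows "[n] \<cdot>\<^bsub>ring_of_type_algebra\<^esub> x = of_nat n * x"
  by (induction n) (simp_all add: add_pow_def nat_pow_def algebra_simps)

locale type_ring_hom = cring R for R :: "('a, 'c) ring_scheme" (structure) +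
  fixes h :: "'b::comm_ring_1 \<Rightarrow> 'a"
  assumes ring_hom: "h \<in> ring_hom ring_of_type_algebra R"
begin

lemma closed [simp]: "h x \<in> carrier R"
  using ring_hom_closed[OF ring_hom] by simp

lemma add: "h (x + y) = h x \<oplus> h y"
  using ring_hom_add[OF ring_hom, of x y] by simp

lemma mult: "h (x * y) = h x \<otimes> h y"
  using ring_hom_mult[OF ring_hom, of x y] by simp

lemma one: "h 1 = \<one>"
  using ring_hom_one[OF ring_hom] by simp

lemma zero: "h 0 = \<zero>"
  using ring_hom_zero[OF ring_hom ring_from_type_algebra ring_axioms] by simp

lemma uminus: "h (- x) = \<ominus> h x"
  using add[of "- x" x] by (intro minus_equality[symmetric]) (auto simp: zero)

lemma power: "h (x ^ n) = h x [^] n"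
  by (induction n) (auto simp: one mult m_comm)

lemma of_nat: "h (of_nat n) = [n] \<cdot> \<one>"
  by (induction n) (auto simp: zero one add a_comm)

lemma eq_if_dvd_diff:
  assumes "[n] \<cdot> \<one> = \<zero>" and "of_nat n dvd x - y"
  shows "h x = h y"
proof -
  obtain c where "x = y + of_nat n * c"
    using assms(2) by (metis dvd_def add.commute diff_add_cancel)
  then show ?thesis by (simp add: add mult of_nat assms(1))
qed

end

abbreviation ZX :: "witt_poly ring" where
  "ZX \<equiv> ring_of_type_algebra"

lemma cring_ZX: "cring ZX"
  by (rule cring_from_type_algebra)

interpretation ZX: cring ZX
  by (rule cring_ZX)

lemma poly_mapping_single_add_induct [case_names single add]:
  fixes f :: "'k \<Rightarrow>\<^sub>0 'c::comm_monoid_add"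
  assumes single: "\<And>m c. Q (Poly_Mapping.single m c)"
    and add: "\<And>f g. Q f \<Longrightarrow> Q g \<Longrightarrow> Q (f + g)"
  shows "Q f"
proof (induction f rule: Poly_Mapping.update_induct)
  case const
  show ?case using single[of undefined 0] by simp
next
  case (update f a b)
  have "Poly_Mapping.update a b f = f + Poly_Mapping.single a b"
    using update(1)
    by (intro poly_mapping_eqI)
       (auto simp: lookup_update lookup_add lookup_single when_def in_keys_iff)
  then show ?case using add single update by simp
qed

lemma poly_var_power: "poly_var v ^ k = Poly_Mapping.single (Poly_Mapping.single v k) 1"
  by (induction k)
     (auto simp: poly_var_def mult_single single_add[symmetric] single_one[symmetric]
       simp del: single_one)

lemma witt_poly_induct [case_names one uminus var add mult]:
  fixes f :: witt_poly
  assumes one: "Q 1" and uminus: "\<And>f. Q f \<Longrightarrow> Q (- f)" and var: "\<And>v. Q (poly_var v)"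
    and add: "\<And>f g. Q f \<Longrightarrow> Q g \<Longrightarrow> Q (f + g)" and mult: "\<And>f g. Q f \<Longrightarrow> Q g \<Longrightarrow> Q (f * g)"
  shows "Q f"
proof (induction f rule: poly_mapping_single_add_induct)
  case (single m c)
  have zero: "Q 0" using add[OF one uminus[OF one]] by simp
  have of_nat: "Q (of_nat n)" for n by (induction n) (auto intro: zero one add)
  have of_int: "Q (of_int c)"
    by (cases c rule: int_cases2) (auto intro: of_nat uminus)
  have power: "Q (poly_var v ^ k)" for v k
    by (induction k) (auto intro: one var mult)
  have monomial: "Q (Poly_Mapping.single m 1)"
  proof (induction m rule: poly_mapping_single_add_induct)
    case (single v k)
    then show ?case using power[of v k] by (simp add: poly_var_power)
  next
    case (add m n)
    then show ?case using mult[OF add] by (simp add: mult_single)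
  qed
  have "Poly_Mapping.single m c = of_int c * Poly_Mapping.single m 1"
    by (simp add: single_of_int[symmetric] mult_single del: single_of_int)
  then show ?case using mult[OF of_int monomial] by simp
qed (rule add)

lemma type_ring_hom_witt_poly_eqI:
  assumes "type_ring_hom R h" and "type_ring_hom R h'"
    and "\<And>v. h (poly_var v) = h' (poly_var v)"
  shows "h f = h' f"
proof -
  interpret h: type_ring_hom R h by fact
  interpret h': type_ring_hom R h' by fact
  show ?thesis
    by (induction f rule: witt_poly_induct)
       (simp_all add: h.one h'.one h.uminus h'.uminus h.add h'.add h.mult h'.mult assms(3))
qed

context cring
begin

definition monomial_value :: "('v \<Rightarrow> 'a) \<Rightarrow> ('v \<Rightarrow>\<^sub>0 nat) \<Rightarrow> 'a" where
  "monomial_value x m = (\<Otimes>v\<in>Poly_Mapping.keys m. x v [^] Poly_Mapping.lookup m v)"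

lemma monomial_value_superset:
  assumes x: "\<And>v. x v \<in> carrier R" and S: "finite S" "Poly_Mapping.keys m \<subseteq> S"
  shows "monomial_value x m = (\<Otimes>v\<in>S. x v [^] Poly_Mapping.lookup m v)"
  unfolding monomial_value_def using S x
  by (intro finprod_mono_neutral_cong_left) (auto simp: in_keys_iff)

lemma monomial_value_closed [simp]:
  "(\<And>v. x v \<in> carrier R) \<Longrightarrow> monomial_value x m \<in> carrier R"
  unfolding monomial_value_def by (intro finprod_closed) auto

lemma monomial_value_add:
  assumes x: "\<And>v. x v \<in> carrier R"
  shows "monomial_value x (m + n) = monomial_value x m \<otimes> monomial_value x n"
proof -
  let ?S = "Poly_Mapping.keys m \<union> Poly_Mapping.keys n"
  have "monomial_value x (m + n) =
      (\<Otimes>v\<in>?S. x v [^] Poly_Mapping.lookup m v \<otimes> x v [^] Poly_Mapping.lookup n v)"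
    using x Poly_Mapping.keys_add[of m n]
    by (subst monomial_value_superset[of x ?S])
       (auto simp: lookup_add nat_pow_mult intro!: finprod_cong')
  also have "\<dots> = (\<Otimes>v\<in>?S. x v [^] Poly_Mapping.lookup m v) \<otimes>
      (\<Otimes>v\<in>?S. x v [^] Poly_Mapping.lookup n v)"
    using x by (intro finprod_multf) auto
  also have "\<dots> = monomial_value x m \<otimes> monomial_value x n"
    using x by (subst (1 2) monomial_value_superset[of x ?S]) auto
  finally show ?thesis .
qed

lemma monomial_value_0 [simp]: "monomial_value x 0 = \<one>"
  by (simp add: monomial_value_def)

lemma monomial_value_single:
  "(\<And>v. x v \<in> carrier R) \<Longrightarrow> monomial_value x (Poly_Mapping.single v k) = x v [^] k"
  by (subst monomial_value_superset[of x "{v}"]) auto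

lemma eval_poly_superset:
  assumes x: "\<And>v. x v \<in> carrier R" and S: "finite S" "Poly_Mapping.keys f \<subseteq> S"
  shows "eval_poly R x f = (\<Oplus>m\<in>S. [Poly_Mapping.lookup f m] \<cdot> monomial_value x m)"
  unfolding eval_poly_def monomial_value_def[symmetric] using S x
  by (intro add.finprod_mono_neutral_cong_left) (auto simp: in_keys_iff add_pow_int_ge)

lemma eval_poly_closed:
  "(\<And>v. x v \<in> carrier R) \<Longrightarrow> eval_poly R x f \<in> carrier R"
  unfolding eval_poly_def monomial_value_def[symmetric] by (intro finsum_closed) auto

lemma eval_poly_plus:
  assumes x: "\<And>v. x v \<in> carrier R"
  shows "eval_poly R x (f + g) = eval_poly R x f \<oplus> eval_poly R x g"
proof -
  let ?S = "Poly_Mapping.keys f \<union> Poly_Mapping.keys g"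
  have "eval_poly R x (f + g) = (\<Oplus>m\<in>?S. [Poly_Mapping.lookup f m] \<cdot> monomial_value x m \<oplus>
      [Poly_Mapping.lookup g m] \<cdot> monomial_value x m)"
    using x Poly_Mapping.keys_add[of f g]
    by (subst eval_poly_superset[of x ?S])
       (auto simp: lookup_add add.int_pow_mult intro!: finsum_cong')
  also have "\<dots> = (\<Oplus>m\<in>?S. [Poly_Mapping.lookup f m] \<cdot> monomial_value x m) \<oplus>
      (\<Oplus>m\<in>?S. [Poly_Mapping.lookup g m] \<cdot> monomial_value x m)"
    using x by (intro finsum_addf) auto
  also have "\<dots> = eval_poly R x f \<oplus> eval_poly R x g"
    using x by (subst (1 2) eval_poly_superset[of x ?S]) auto
  finally show ?thesis .
qed

lemma eval_poly_single:
  "(\<And>v. x v \<in> carrier R) \<Longrightarrow>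
    eval_poly R x (Poly_Mapping.single m c) = [c] \<cdot> monomial_value x m"
  by (subst eval_poly_superset[of x "{m}"]) auto

lemma eval_poly_times:
  assumes x: "\<And>v. x v \<in> carrier R"
  shows "eval_poly R x (f * g) = eval_poly R x f \<otimes> eval_poly R x g"
proof (induction f rule: poly_mapping_single_add_induct)
  case (single m c)
  show ?case
  proof (induction g rule: poly_mapping_single_add_induct)
    case (single n d)
    have "([c] \<cdot> monomial_value x m) \<otimes> ([d] \<cdot> monomial_value x n) =
        [(c * d)] \<cdot> (monomial_value x m \<otimes> monomial_value x n)"
      using x by (simp add: add_pow_ldistr_int add_pow_rdistr_int add.int_pow_pow mult.commute)
    then show ?case
      using x by (simp add: mult_single eval_poly_single monomial_value_add)
  next
    case (add f g)
    then show ?case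
      using x by (simp add: distrib_left eval_poly_plus eval_poly_closed r_distr)
  qed
next
  case (add f g)
  then show ?case
    using x by (simp add: distrib_right eval_poly_plus eval_poly_closed l_distr)
qed

lemma eval_poly_var:
  "(\<And>v. x v \<in> carrier R) \<Longrightarrow> eval_poly R x (poly_var v) = x v"
  unfolding poly_var_def by (subst eval_poly_single) (auto simp: monomial_value_single)

lemma type_ring_hom_eval_poly:
  assumes x: "\<And>v. x v \<in> carrier R"
  shows "type_ring_hom R (eval_poly R x)"
proof (unfold_locales, rule ring_hom_memI)
  show "eval_poly R x \<one>\<^bsub>ZX\<^esub> = \<one>"
    using eval_poly_single[of x 0 1, OF x] by simp
qed (simp_all add: x eval_poly_closed eval_poly_plus eval_poly_times)

end

lemma ring_hom_eval_poly:
  assumes R: "cring R" and S: "cring S" and g: "g \<in> ring_hom R S"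
    and x: "\<And>v. x v \<in> carrier R"
  shows "g (eval_poly R x f) = eval_poly S (g \<circ> x) f"
proof -
  have gx: "(g \<circ> x) v \<in> carrier S" for v
    using ring_hom_closed[OF g x] by simp
  have "g \<circ> eval_poly R x \<in> ring_hom ZX S"
    using ring_hom_trans[OF type_ring_hom.ring_hom[OF cring.type_ring_hom_eval_poly[OF R, of x, OF x]] g] .
  then have "type_ring_hom S (g \<circ> eval_poly R x)"
    by (intro type_ring_hom.intro type_ring_hom_axioms.intro S)
  then have "(g \<circ> eval_poly R x) f = eval_poly S (g \<circ> x) f"
    by (rule type_ring_hom_witt_poly_eqI[OF _ cring.type_ring_hom_eval_poly[OF S gx]])
       (simp add: cring.eval_poly_var R S x ring_hom_closed[OF g x])
  then show ?thesis by simp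
qed

section \<open>Congruences between powers\<close>

lemma of_nat_prime_dvd_power_add:
  fixes x y :: "'c::comm_ring_1"
  assumes p: "Factorial_Ring.prime p"
  shows "of_nat p dvd (x + y) ^ p - (x ^ p + y ^ p)"
proof -
  let ?t = "\<lambda>k. of_nat (p choose k) * x ^ k * y ^ (p - k)"
  have "(x + y) ^ p = (\<Sum>k\<le>p. ?t k)"
    by (rule binomial_ring)
  also have "\<dots> = (\<Sum>k\<in>{0,p}. ?t k) + (\<Sum>k\<in>{..p} - {0,p}. ?t k)"
    by (subst sum.subset_diff[of "{0,p}" "{..p}"]) (auto simp: add.commute)
  also have "(\<Sum>k\<in>{0,p}. ?t k) = x ^ p + y ^ p"
    using prime_gt_0_nat[OF p] by simp
  finally have "(x + y) ^ p - (x ^ p + y ^ p) = (\<Sum>k\<in>{..p} - {0,p}. ?t k)"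
    by simp
  moreover have "of_nat p dvd ?t k" if "k \<in> {..p} - {0,p}" for k
  proof -
    have "p dvd (p choose k)" using p that by (intro dvd_choose_prime) auto
    then have "(of_nat p :: 'c) dvd of_nat (p choose k)" by auto
    then show ?thesis by (metis dvd_mult2)
  qed
  ultimately show ?thesis by (metis (no_types, lifting) dvd_sum)
qed

lemma of_nat_power_Suc_dvd_power_diff:
  fixes x y :: "'c::comm_ring_1"
  assumes xy: "of_nat (n ^ Suc k) dvd x - y"
  shows "of_nat (n ^ Suc (Suc k)) dvd x ^ n - y ^ n"
proof -
  have n: "of_nat n dvd x - y"
    using xy by (metis dvd_mult_left of_nat_mult power_Suc)
  have cong: "of_nat n dvd x ^ i - y ^ i" for i
    using n by (metis dvd_mult2 power_diff_sumr2)
  have "(\<Sum>i<n. y ^ (n - Suc i) * x ^ i) =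
      (\<Sum>i<n. y ^ (n - Suc i) * (x ^ i - y ^ i)) + (\<Sum>i<n. y ^ (n - Suc i) * y ^ i)"
    by (simp add: sum.distrib[symmetric] algebra_simps)
  also have "(\<Sum>i<n. y ^ (n - Suc i) * y ^ i) = of_nat n * y ^ (n - 1)"
    by (simp add: power_add[symmetric])
  finally have "of_nat n dvd (\<Sum>i<n. y ^ (n - Suc i) * x ^ i)"
    using cong by (auto intro!: dvd_add dvd_sum)
  then have "of_nat (n ^ Suc k) * of_nat n dvd (x - y) * (\<Sum>i<n. y ^ (n - Suc i) * x ^ i)"
    using xy by (rule mult_dvd_mono[rotated])
  then show ?thesis
    by (simp add: power_diff_sumr2 mult.commute)
qed

lemma of_nat_power_dvd_power_diff:
  fixes x y :: "'c::comm_ring_1"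
  assumes "of_nat n dvd x - y"
  shows "of_nat (n ^ Suc k) dvd x ^ (n ^ k) - y ^ (n ^ k)"
proof (induction k)
  case 0
  then show ?case using assms by simp
next
  case (Suc k)
  from of_nat_power_Suc_dvd_power_diff[OF this] show ?case
    by (simp add: power_mult[symmetric] mult.commute)
qed

section \<open>Witt's theorem\<close>

lemma of_nat_mult_cancel_poly_mapping:
  fixes f g :: "'m::monoid_add \<Rightarrow>\<^sub>0 'c::{ring_char_0, idom}"
  assumes "n > 0" "of_nat n * f = of_nat n * g"
  shows "f = g"
proof (rule poly_mapping_eqI)
  fix m
  have "Poly_Mapping.lookup (of_nat k * f) m = of_nat k * Poly_Mapping.lookup f m"
    for k and f :: "'m \<Rightarrow>\<^sub>0 'c"
    by (induction k) (auto simp: lookup_add distrib_right)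
  from this[of n f] this[of n g] show "Poly_Mapping.lookup f m = Poly_Mapping.lookup g m"
    using assms by simp
qed

definition frob_lift :: "nat \<Rightarrow> witt_poly \<Rightarrow> witt_poly" where
  "frob_lift p = eval_poly ZX (\<lambda>v. poly_var v ^ p)"

interpretation frob_lift: type_ring_hom ZX "frob_lift p" for p
  unfolding frob_lift_def by (rule ZX.type_ring_hom_eval_poly) simp

lemma frob_lift_var: "frob_lift p (poly_var v) = poly_var v ^ p"
  by (simp add: frob_lift_def ZX.eval_poly_var)

lemmas frob_lift_simps [simp] =
  frob_lift_var frob_lift.add[simplified] frob_lift.mult[simplified] frob_lift.one[simplified]
  frob_lift.uminus[simplified]

lemma prime_dvd_frob_lift_diff_power:
  assumes p: "Factorial_Ring.prime p"
  shows "of_nat p dvd frob_lift p f - f ^ p"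
proof (induction f rule: witt_poly_induct)
  case one
  show ?case by simp
next
  case (uminus f)
  show ?case
  proof (cases "even p")
    case True
    then have "p = 2" using p by (metis prime_odd_nat prime_ge_2_nat le_neq_implies_less)
    then have "frob_lift p (- f) - (- f) ^ p = - (frob_lift p f - f ^ p) - of_nat p * f ^ p"
      by simp
    then show ?thesis using uminus by (metis dvd_diff dvd_minus_iff dvd_triv_left)
  next
    case False
    then have "frob_lift p (- f) - (- f) ^ p = - (frob_lift p f - f ^ p)"
      by simp
    then show ?thesis using uminus by (metis dvd_minus_iff)
  qed
next
  case (var v)
  show ?case by simp
next
  case (add f g)
  have "frob_lift p (f + g) - (f + g) ^ p =
      (frob_lift p f - f ^ p) + (frob_lift p g - g ^ p) - ((f + g) ^ p - (f ^ p + g ^ p))"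
    by simp
  then show ?case
    using add of_nat_prime_dvd_power_add[OF p, of f g] by (metis dvd_add dvd_diff)
next
  case (mult f g)
  have "frob_lift p (f * g) - (f * g) ^ p =
      (frob_lift p f - f ^ p) * frob_lift p g + f ^ p * (frob_lift p g - g ^ p)"
    by (simp add: algebra_simps power_mult_distrib)
  then show ?case using mult by (metis dvd_add dvd_mult dvd_mult2)
qed

lemma type_ring_hom_ghost:
  assumes "type_ring_hom ZX h"
  shows "h (ghost p a n) = ghost p (h \<circ> a) n"
proof -
  interpret h: type_ring_hom ZX h by fact
  have "h (sum f A) = (\<Sum>i\<in>A. h (f i))" for f and A :: "nat set"
    by (induction A rule: infinite_finite_induct) (simp_all add: h.zero h.add)
  then show ?thesis
    by (simp add: ghost_def h.mult h.power h.of_nat del: of_nat_power)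
qed

lemma ghost_cong: "(\<And>i. i \<le> n \<Longrightarrow> a i = b i) \<Longrightarrow> ghost p a n = ghost p b n"
  by (simp add: ghost_def)

lemma ghost_0 [simp]: "ghost p a 0 = a 0"
  by (simp add: ghost_def)

lemma ghost_Suc:
  "ghost p a (Suc n) = ghost p (\<lambda>i. a i ^ p) n + of_nat (p ^ Suc n) * a (Suc n)"
  by (simp add: ghost_def Suc_diff_le power_mult[symmetric] del: of_nat_power)

lemma ghost_eq_lower_plus_top:
  "ghost p a n = (\<Sum>i<n. of_nat (p ^ i) * a i ^ (p ^ (n - i))) + of_nat (p ^ n) * a n"
  by (simp add: ghost_def lessThan_Suc_atMost[symmetric])

lemma ghost_diff_dvd:
  assumes ab: "\<And>i. i \<le> n \<Longrightarrow> of_nat p dvd a i - b i"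
  shows "of_nat (p ^ Suc n) dvd ghost p a n - ghost p b n"
proof -
  have "ghost p a n - ghost p b n =
      (\<Sum>i\<le>n. of_nat (p ^ i) * (a i ^ (p ^ (n - i)) - b i ^ (p ^ (n - i))))"
    by (simp add: ghost_def sum_subtractf right_diff_distrib)
  also have "of_nat (p ^ Suc n) dvd \<dots>"
  proof (rule dvd_sum)
    fix i assume i: "i \<in> {..n}"
    have "p ^ Suc n = p ^ i * p ^ Suc (n - i)"
      using i by (simp flip: power_add)
    then show "(of_nat (p ^ Suc n) :: witt_poly) dvd
        of_nat (p ^ i) * (a i ^ (p ^ (n - i)) - b i ^ (p ^ (n - i)))"
      unfolding \<open>p ^ Suc n = _\<close> of_nat_mult
      using i ab by (intro mult_dvd_mono of_nat_power_dvd_power_diff) auto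
  qed
  finally show ?thesis .
qed

lemma dvd_diff_if_ghost_diff_dvd:
  assumes p: "p > 0" and ghost: "\<And>k. of_nat (p ^ Suc k) dvd ghost p a k - ghost p b k"
  shows "of_nat p dvd a n - b n"
proof (induction n rule: less_induct)
  case (less n)
  let ?b = "b(n := a n)"
  have "of_nat (p ^ Suc n) dvd ghost p a n - ghost p ?b n"
    using less.IH by (intro ghost_diff_dvd) auto
  with ghost have "of_nat (p ^ Suc n) dvd
      (ghost p a n - ghost p b n) - (ghost p a n - ghost p ?b n)"
    by (rule dvd_diff)
  also have "\<dots> = of_nat (p ^ n) * (a n - b n)"
    by (simp add: ghost_eq_lower_plus_top algebra_simps)
  finally obtain c where "of_nat (p ^ n) * (a n - b n) = of_nat (p ^ Suc n) * c"
    by (rule dvdE)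
  then have "of_nat (p ^ n) * (a n - b n) = of_nat (p ^ n) * (of_nat p * c)"
    by (simp add: mult_ac)
  then have "a n - b n = of_nat p * c"
    using p by (intro of_nat_mult_cancel_poly_mapping[of "p ^ n" "a n - b n"]) auto
  then show ?case by simp
qed

lemma ghost_inj:
  assumes p: "p > 0" and eq: "\<And>k. k \<le> n \<Longrightarrow> ghost p a k = ghost p b k"
  shows "a n = b n"
  using eq
proof (induction n rule: less_induct)
  case (less n)
  have "a i = b i" if "i < n" for i
    using that by (intro less.IH less.prems) auto
  then have "of_nat (p ^ n) * a n = of_nat (p ^ n) * b n"
    using less.prems[of n] by (simp add: ghost_eq_lower_plus_top)
  then show ?case
    using p by (intro of_nat_mult_cancel_poly_mapping[of "p ^ n" "a n" "b n"]) auto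
qed

definition ghost_compatible :: "nat \<Rightarrow> (nat \<Rightarrow> witt_poly) \<Rightarrow> bool" where
  "ghost_compatible p g \<longleftrightarrow> (\<forall>n. of_nat (p ^ Suc n) dvd g (Suc n) - frob_lift p (g n))"

lemma ghost_compatible_ghost:
  assumes p: "Factorial_Ring.prime p"
  shows "ghost_compatible p (ghost p a)"
  unfolding ghost_compatible_def
proof
  fix n
  have "of_nat (p ^ Suc n) dvd ghost p (\<lambda>i. a i ^ p) n - ghost p (frob_lift p \<circ> a) n"
  proof (rule ghost_diff_dvd)
    show "of_nat p dvd a i ^ p - (frob_lift p \<circ> a) i" for i
      using prime_dvd_frob_lift_diff_power[OF p, of "a i"]
        dvd_minus_iff[of _ "frob_lift p (a i) - a i ^ p"] by simp
  qed
  then have "of_nat (p ^ Suc n) dvd of_nat (p ^ Suc n) * a (Suc n) +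
      (ghost p (\<lambda>i. a i ^ p) n - ghost p (frob_lift p \<circ> a) n)"
    by (intro dvd_add dvd_triv_left)
  then show "of_nat (p ^ Suc n) dvd ghost p a (Suc n) - frob_lift p (ghost p a n)"
    by (simp only: ghost_Suc type_ring_hom_ghost[OF frob_lift.type_ring_hom_axioms]
        add.commute add_diff_eq)
qed

lemma ghost_compatible_add:
  assumes "ghost_compatible p g" "ghost_compatible p h"
  shows "ghost_compatible p (\<lambda>n. g n + h n)"
  unfolding ghost_compatible_def
proof
  fix n
  have "g (Suc n) + h (Suc n) - frob_lift p (g n + h n) =
      (g (Suc n) - frob_lift p (g n)) + (h (Suc n) - frob_lift p (h n))"
    by simp
  then show "of_nat (p ^ Suc n) dvd g (Suc n) + h (Suc n) - frob_lift p (g n + h n)"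
    using assms unfolding ghost_compatible_def by (metis dvd_add)
qed

lemma ghost_compatible_uminus:
  assumes "ghost_compatible p g"
  shows "ghost_compatible p (\<lambda>n. - g n)"
  unfolding ghost_compatible_def
proof
  fix n
  have "- g (Suc n) - frob_lift p (- g n) = - (g (Suc n) - frob_lift p (g n))"
    by simp
  then show "of_nat (p ^ Suc n) dvd - g (Suc n) - frob_lift p (- g n)"
    using assms unfolding ghost_compatible_def by (metis dvd_minus_iff)
qed

lemma ghost_compatible_mult:
  assumes "ghost_compatible p g" "ghost_compatible p h"
  shows "ghost_compatible p (\<lambda>n. g n * h n)"
  unfolding ghost_compatible_def
proof
  fix n
  have "g (Suc n) * h (Suc n) - frob_lift p (g n * h n) =
      (g (Suc n) - frob_lift p (g n)) * h (Suc n) +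
      frob_lift p (g n) * (h (Suc n) - frob_lift p (h n))"
    by (simp add: algebra_simps)
  then show "of_nat (p ^ Suc n) dvd g (Suc n) * h (Suc n) - frob_lift p (g n * h n)"
    using assms unfolding ghost_compatible_def by (metis dvd_add dvd_mult dvd_mult2)
qed

lemma ghost_preimage_prefix:
  assumes p: "Factorial_Ring.prime p" and g: "ghost_compatible p g"
  shows "\<exists>a. \<forall>k\<le>n. ghost p a k = g k"
proof (induction n)
  case 0
  show ?case by (intro exI[of _ "\<lambda>_. g 0"]) simp
next
  case (Suc n)
  then obtain a where a: "\<And>k. k \<le> n \<Longrightarrow> ghost p a k = g k" by blast
  have "of_nat (p ^ Suc n) dvd ghost p a (Suc n) - frob_lift p (g n)"
    using ghost_compatible_ghost[OF p, of a] a by (metis ghost_compatible_def order_refl)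
  moreover have "of_nat (p ^ Suc n) dvd g (Suc n) - frob_lift p (g n)"
    using g by (simp add: ghost_compatible_def)
  ultimately have "of_nat (p ^ Suc n) dvd
      (g (Suc n) - frob_lift p (g n)) - (ghost p a (Suc n) - frob_lift p (g n))"
    by (rule dvd_diff[rotated])
  then obtain z where "g (Suc n) - ghost p a (Suc n) = of_nat (p ^ Suc n) * z"
    by (auto simp: dvd_def)
  then have z: "g (Suc n) = ghost p a (Suc n) + of_nat (p ^ Suc n) * z"
    by (metis add.commute diff_add_cancel)
  let ?b = "a(Suc n := a (Suc n) + z)"
  have "ghost p ?b k = g k" if "k \<le> Suc n" for k
  proof (cases "k = Suc n")
    case True
    have "ghost p ?b (Suc n) = ghost p a (Suc n) + of_nat (p ^ Suc n) * z"
      by (simp add: ghost_eq_lower_plus_top distrib_left add.assoc)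
    then show ?thesis using z True by simp
  next
    case False
    then have "ghost p ?b k = ghost p a k" using that by (intro ghost_cong) auto
    then show ?thesis using False that a by simp
  qed
  then show ?case by blast
qed

lemma ghost_preimage_ex1:
  assumes p: "Factorial_Ring.prime p" and g: "ghost_compatible p g"
  shows "\<exists>!a. \<forall>n. ghost p a n = g n"
proof -
  have p_pos: "p > 0" using p by (rule prime_gt_0_nat)
  obtain b where b: "\<And>n k. k \<le> n \<Longrightarrow> ghost p (b n) k = g k"
    using ghost_preimage_prefix[OF p g] by metis
  have "ghost p (\<lambda>i. b i i) n = g n" for n
  proof -
    have "b i i = b n i" if "i \<le> n" for i
      using that by (intro ghost_inj[OF p_pos, of i "b i" "b n"]) (simp add: b)
    then have "ghost p (\<lambda>i. b i i) n = ghost p (b n) n"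
      by (intro ghost_cong)
    then show ?thesis by (simp add: b)
  qed
  moreover have "a = a'" if "\<forall>n. ghost p a n = g n" "\<forall>n. ghost p a' n = g n" for a a'
    using that by (intro ext ghost_inj[OF p_pos, of _ a a']) simp
  ultimately show ?thesis by blast
qed

lemma ghost_witt_sum:
  assumes p: "Factorial_Ring.prime p"
  shows "ghost p (witt_sum p) n =
    ghost p (\<lambda>i. poly_var (Inl i)) n + ghost p (\<lambda>i. poly_var (Inr i)) n"
  using theI'[OF ghost_preimage_ex1[OF p ghost_compatible_add[OF
    ghost_compatible_ghost[OF p, of "\<lambda>i. poly_var (Inl i)"]
    ghost_compatible_ghost[OF p, of "\<lambda>i. poly_var (Inr i)"]]]]
  unfolding witt_sum_def by blast

lemma ghost_witt_prod:
  assumes p: "Factorial_Ring.prime p"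
  shows "ghost p (witt_prod p) n =
    ghost p (\<lambda>i. poly_var (Inl i)) n * ghost p (\<lambda>i. poly_var (Inr i)) n"
  using theI'[OF ghost_preimage_ex1[OF p ghost_compatible_mult[OF
    ghost_compatible_ghost[OF p, of "\<lambda>i. poly_var (Inl i)"]
    ghost_compatible_ghost[OF p, of "\<lambda>i. poly_var (Inr i)"]]]]
  unfolding witt_prod_def by blast

section \<open>The ring of Witt vectors\<close>

lemma carrier_Witt [simp]: "a \<in> carrier (Witt p R) \<longleftrightarrow> (\<forall>n. a n \<in> carrier R)"
  by (simp add: Witt_def)

lemma Witt_zero: "\<zero>\<^bsub>Witt p R\<^esub> = (\<lambda>n. \<zero>\<^bsub>R\<^esub>)"
  by (simp add: Witt_def)

lemma Witt_one: "\<one>\<^bsub>Witt p R\<^esub> = (\<lambda>n. if n = 0 then \<one>\<^bsub>R\<^esub> else \<zero>\<^bsub>R\<^esub>)"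
  by (simp add: Witt_def)

lemma Witt_add: "a \<oplus>\<^bsub>Witt p R\<^esub> b = (\<lambda>n. eval_poly R (case_sum a b) (witt_sum p n))"
  by (simp add: Witt_def)

lemma Witt_mult: "a \<otimes>\<^bsub>Witt p R\<^esub> b = (\<lambda>n. eval_poly R (case_sum a b) (witt_prod p n))"
  by (simp add: Witt_def)

lemma case_sum_closed:
  "a \<in> carrier (Witt p R) \<Longrightarrow> b \<in> carrier (Witt p R) \<Longrightarrow> case_sum a b v \<in> carrier R"
  by (cases v) auto

lemma ring_hom_comp_Witt:
  assumes R: "cring R" and S: "cring S" and g: "g \<in> ring_hom R S"
  shows "(\<circ>) g \<in> ring_hom (Witt p R) (Witt p S)"
proof (rule ring_hom_memI)
  fix a b assume ab: "a \<in> carrier (Witt p R)" "b \<in> carrier (Witt p R)"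
  show "g \<circ> a \<in> carrier (Witt p S)"
    using ab(1) ring_hom_closed[OF g] by simp
  have "g (eval_poly R (case_sum a b) f) = eval_poly S (case_sum (g \<circ> a) (g \<circ> b)) f" for f
    using ring_hom_eval_poly[OF R S g, of "case_sum a b"] case_sum_closed[OF ab]
    by (simp add: case_sum_o_inj o_case_sum)
  then show "g \<circ> (a \<otimes>\<^bsub>Witt p R\<^esub> b) = (g \<circ> a) \<otimes>\<^bsub>Witt p S\<^esub> (g \<circ> b)"
    "g \<circ> (a \<oplus>\<^bsub>Witt p R\<^esub> b) = (g \<circ> a) \<oplus>\<^bsub>Witt p S\<^esub> (g \<circ> b)"
    by (simp_all add: fun_eq_iff Witt_mult Witt_add)
next
  show "g \<circ> \<one>\<^bsub>Witt p R\<^esub> = \<one>\<^bsub>Witt p S\<^esub>"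
    using ring_hom_one[OF g] ring_hom_zero[OF g cring.axioms(1)[OF R] cring.axioms(1)[OF S]]
    by (simp add: fun_eq_iff Witt_one)
qed

lemma (in cring) witt_vectors_over_ZX:
  assumes abc: "a \<in> carrier (Witt p R)" "b \<in> carrier (Witt p R)" "c \<in> carrier (Witt p R)"
  obtains h A B C where "h \<in> ring_hom ZX R" "a = h \<circ> A" "b = h \<circ> B" "c = h \<circ> C"
proof (rule that)
  let ?x = "case_sum a (\<lambda>i. if even i then b (i div 2) else c (i div 2))"
  have x: "?x v \<in> carrier R" for v
    using abc by (cases v) auto
  show "eval_poly R ?x \<in> ring_hom ZX R"
    using type_ring_hom_eval_poly[OF x] by (rule type_ring_hom.ring_hom)
  show "a = eval_poly R ?x \<circ> (\<lambda>i. poly_var (Inl i))"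
    "b = eval_poly R ?x \<circ> (\<lambda>i. poly_var (Inr (2 * i)))"
    "c = eval_poly R ?x \<circ> (\<lambda>i. poly_var (Inr (2 * i + 1)))"
    by (simp_all add: fun_eq_iff eval_poly_var x)
qed

lemma ghost_Witt_add:
  assumes p: "Factorial_Ring.prime p"
  shows "ghost p (a \<oplus>\<^bsub>Witt p ZX\<^esub> b) n = ghost p a n + ghost p b n"
proof -
  interpret h: type_ring_hom ZX "eval_poly ZX (case_sum a b)"
    by (rule ZX.type_ring_hom_eval_poly) simp
  note h_ghost = type_ring_hom_ghost[OF h.type_ring_hom_axioms]
  have "ghost p (a \<oplus>\<^bsub>Witt p ZX\<^esub> b) n = eval_poly ZX (case_sum a b) (ghost p (witt_sum p) n)"
    by (simp add: Witt_add h_ghost comp_def)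
  then show ?thesis
    by (simp add: ghost_witt_sum[OF p] h.add h_ghost comp_def ZX.eval_poly_var)
qed

lemma ghost_Witt_mult:
  assumes p: "Factorial_Ring.prime p"
  shows "ghost p (a \<otimes>\<^bsub>Witt p ZX\<^esub> b) n = ghost p a n * ghost p b n"
proof -
  interpret h: type_ring_hom ZX "eval_poly ZX (case_sum a b)"
    by (rule ZX.type_ring_hom_eval_poly) simp
  note h_ghost = type_ring_hom_ghost[OF h.type_ring_hom_axioms]
  have "ghost p (a \<otimes>\<^bsub>Witt p ZX\<^esub> b) n = eval_poly ZX (case_sum a b) (ghost p (witt_prod p) n)"
    by (simp add: Witt_mult h_ghost comp_def)
  then show ?thesis
    by (simp add: ghost_witt_prod[OF p] h.mult h_ghost comp_def ZX.eval_poly_var)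
qed

lemma ghost_Witt_zero: "p > 0 \<Longrightarrow> ghost p \<zero>\<^bsub>Witt p ZX\<^esub> n = 0"
  by (simp add: ghost_def Witt_zero zero_power)

lemma ghost_Witt_one: "p > 0 \<Longrightarrow> ghost p \<one>\<^bsub>Witt p ZX\<^esub> n = 1"
  by (simp add: ghost_def Witt_one if_distrib zero_power sum.atMost_shift cong: if_cong)

lemma cring_Witt_ZX:
  assumes p: "Factorial_Ring.prime p"
  shows "cring (Witt p ZX)"
proof -
  have p_pos: "p > 0" using p by (rule prime_gt_0_nat)
  have ghost_eqI: "a = b" if "\<And>n. ghost p a n = ghost p b n" for a b
    using that by (intro ext ghost_inj[OF p_pos, of _ a b])
  note ghost_simps = ghost_Witt_add[OF p] ghost_Witt_mult[OF p] ghost_Witt_zero[OF p_pos]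
    ghost_Witt_one[OF p_pos]
  show ?thesis
  proof (intro cringI abelian_groupI comm_monoidI)
    fix a assume "a \<in> carrier (Witt p ZX)"
    obtain b where "\<And>n. ghost p b n = - ghost p a n"
      using ghost_preimage_ex1[OF p ghost_compatible_uminus[OF ghost_compatible_ghost[OF p]]]
      by blast
    then have "b \<oplus>\<^bsub>Witt p ZX\<^esub> a = \<zero>\<^bsub>Witt p ZX\<^esub>"
      by (intro ghost_eqI) (simp add: ghost_simps)
    then show "\<exists>b\<in>carrier (Witt p ZX). b \<oplus>\<^bsub>Witt p ZX\<^esub> a = \<zero>\<^bsub>Witt p ZX\<^esub>"
      by auto
  qed (simp; fail | rule ghost_eqI, simp add: ghost_simps algebra_simps)+
qed

lemma (in cring) comp_Witt_ZX:
  assumes h: "h \<in> ring_hom ZX R"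
  shows "h \<circ> (a \<oplus>\<^bsub>Witt p ZX\<^esub> b) = (h \<circ> a) \<oplus>\<^bsub>Witt p R\<^esub> (h \<circ> b)"
    and "h \<circ> (a \<otimes>\<^bsub>Witt p ZX\<^esub> b) = (h \<circ> a) \<otimes>\<^bsub>Witt p R\<^esub> (h \<circ> b)"
    and "h \<circ> \<zero>\<^bsub>Witt p ZX\<^esub> = \<zero>\<^bsub>Witt p R\<^esub>"
    and "h \<circ> \<one>\<^bsub>Witt p ZX\<^esub> = \<one>\<^bsub>Witt p R\<^esub>"
proof -
  note comp_hom = ring_hom_comp_Witt[OF cring_ZX is_cring h, of p]
  show "h \<circ> (a \<oplus>\<^bsub>Witt p ZX\<^esub> b) = (h \<circ> a) \<oplus>\<^bsub>Witt p R\<^esub> (h \<circ> b)"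
    "h \<circ> (a \<otimes>\<^bsub>Witt p ZX\<^esub> b) = (h \<circ> a) \<otimes>\<^bsub>Witt p R\<^esub> (h \<circ> b)"
    "h \<circ> \<one>\<^bsub>Witt p ZX\<^esub> = \<one>\<^bsub>Witt p R\<^esub>"
    by (simp_all add: ring_hom_add[OF comp_hom] ring_hom_mult[OF comp_hom] ring_hom_one[OF comp_hom])
  show "h \<circ> \<zero>\<^bsub>Witt p ZX\<^esub> = \<zero>\<^bsub>Witt p R\<^esub>"
    using ring_hom_zero[OF h ZX.ring_axioms ring_axioms] by (simp add: Witt_zero comp_def)
qed

lemma (in cring) abelian_group_Witt:
  assumes p: "Factorial_Ring.prime p"
  shows "abelian_group (Witt p R)"
proof -
  interpret W: cring "Witt p ZX" by (rule cring_Witt_ZX[OF p])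
  show ?thesis
  proof (rule abelian_groupI)
    fix a b c assume abc: "a \<in> carrier (Witt p R)" "b \<in> carrier (Witt p R)" "c \<in> carrier (Witt p R)"
    then obtain h A B C where h: "h \<in> ring_hom ZX R" "a = h \<circ> A" "b = h \<circ> B" "c = h \<circ> C"
      by (rule witt_vectors_over_ZX)
    show "a \<oplus>\<^bsub>Witt p R\<^esub> b \<oplus>\<^bsub>Witt p R\<^esub> c = a \<oplus>\<^bsub>Witt p R\<^esub> (b \<oplus>\<^bsub>Witt p R\<^esub> c)"
      by (simp add: h(2-4) W.a_assoc flip: comp_Witt_ZX[OF h(1)])
  next
    fix a b assume ab: "a \<in> carrier (Witt p R)" "b \<in> carrier (Witt p R)"
    then obtain h A B where h: "h \<in> ring_hom ZX R" "a = h \<circ> A" "b = h \<circ> B"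
      using witt_vectors_over_ZX by metis
    show "a \<oplus>\<^bsub>Witt p R\<^esub> b = b \<oplus>\<^bsub>Witt p R\<^esub> a"
      by (simp add: h(2,3) W.a_comm flip: comp_Witt_ZX[OF h(1)])
    show "a \<oplus>\<^bsub>Witt p R\<^esub> b \<in> carrier (Witt p R)"
      by (simp add: Witt_add eval_poly_closed case_sum_closed[OF ab])
  next
    fix a assume "a \<in> carrier (Witt p R)"
    then obtain h A where h: "h \<in> ring_hom ZX R" "a = h \<circ> A"
      using witt_vectors_over_ZX by metis
    show "\<zero>\<^bsub>Witt p R\<^esub> \<oplus>\<^bsub>Witt p R\<^esub> a = a"
      using W.l_zero[of A] by (simp add: h(2) flip: comp_Witt_ZX[OF h(1)])
    show "\<exists>b\<in>carrier (Witt p R). b \<oplus>\<^bsub>Witt p R\<^esub> a = \<zero>\<^bsub>Witt p R\<^esub>"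
      using W.l_neg[of A] ring_hom_closed[OF h(1)]
      by (intro bexI[of _ "h \<circ> (\<ominus>\<^bsub>Witt p ZX\<^esub> A)"]) (simp_all add: h(2) flip: comp_Witt_ZX[OF h(1)])
  qed (simp add: Witt_zero)
qed

lemma (in cring) comm_monoid_Witt:
  assumes p: "Factorial_Ring.prime p"
  shows "comm_monoid (Witt p R)"
proof -
  interpret W: cring "Witt p ZX" by (rule cring_Witt_ZX[OF p])
  show ?thesis
  proof (rule comm_monoidI)
    fix a b c assume "a \<in> carrier (Witt p R)" "b \<in> carrier (Witt p R)" "c \<in> carrier (Witt p R)"
    then obtain h A B C where h: "h \<in> ring_hom ZX R" "a = h \<circ> A" "b = h \<circ> B" "c = h \<circ> C"
      by (rule witt_vectors_over_ZX)
    show "a \<otimes>\<^bsub>Witt p R\<^esub> b \<otimes>\<^bsub>Witt p R\<^esub> c = a \<otimes>\<^bsub>Witt p R\<^esub> (b \<otimes>\<^bsub>Witt p R\<^esub> c)"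
      by (simp add: h(2-4) W.m_assoc flip: comp_Witt_ZX[OF h(1)])
  next
    fix a b assume ab: "a \<in> carrier (Witt p R)" "b \<in> carrier (Witt p R)"
    then obtain h A B where h: "h \<in> ring_hom ZX R" "a = h \<circ> A" "b = h \<circ> B"
      using witt_vectors_over_ZX by metis
    show "a \<otimes>\<^bsub>Witt p R\<^esub> b = b \<otimes>\<^bsub>Witt p R\<^esub> a"
      by (simp add: h(2,3) W.m_comm flip: comp_Witt_ZX[OF h(1)])
    show "a \<otimes>\<^bsub>Witt p R\<^esub> b \<in> carrier (Witt p R)"
      by (simp add: Witt_mult eval_poly_closed case_sum_closed[OF ab])
  next
    fix a assume "a \<in> carrier (Witt p R)"
    then obtain h A where h: "h \<in> ring_hom ZX R" "a = h \<circ> A"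
      using witt_vectors_over_ZX by metis
    show "\<one>\<^bsub>Witt p R\<^esub> \<otimes>\<^bsub>Witt p R\<^esub> a = a"
      using W.l_one[of A] by (simp add: h(2) flip: comp_Witt_ZX[OF h(1)])
  qed (simp add: Witt_one)
qed

theorem (in cring) cring_Witt:
  assumes p: "Factorial_Ring.prime p"
  shows "cring (Witt p R)"
proof -
  interpret W: cring "Witt p ZX" by (rule cring_Witt_ZX[OF p])
  show ?thesis
  proof (rule cringI[OF abelian_group_Witt[OF p] comm_monoid_Witt[OF p]])
    fix a b c assume "a \<in> carrier (Witt p R)" "b \<in> carrier (Witt p R)" "c \<in> carrier (Witt p R)"
    then obtain h A B C where h: "h \<in> ring_hom ZX R" "a = h \<circ> A" "b = h \<circ> B" "c = h \<circ> C"
      by (rule witt_vectors_over_ZX)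
    show "(a \<oplus>\<^bsub>Witt p R\<^esub> b) \<otimes>\<^bsub>Witt p R\<^esub> c = a \<otimes>\<^bsub>Witt p R\<^esub> c \<oplus>\<^bsub>Witt p R\<^esub> b \<otimes>\<^bsub>Witt p R\<^esub> c"
      by (simp add: h(2-4) W.l_distr flip: comp_Witt_ZX[OF h(1)])
  qed
qed

lemma (in cring) Witt_component_0_ring_hom:
  assumes p: "Factorial_Ring.prime p"
  shows "(\<lambda>a. a 0) \<in> ring_hom (Witt p R) R"
proof (rule ring_hom_memI)
  fix a b assume ab: "a \<in> carrier (Witt p R)" "b \<in> carrier (Witt p R)"
  have "witt_sum p 0 = poly_var (Inl 0) + poly_var (Inr 0)"
    using ghost_witt_sum[OF p, of 0] by simp
  then show "(a \<oplus>\<^bsub>Witt p R\<^esub> b) 0 = a 0 \<oplus> b 0"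
    by (simp add: Witt_add eval_poly_plus eval_poly_var case_sum_closed[OF ab])
  have "witt_prod p 0 = poly_var (Inl 0) * poly_var (Inr 0)"
    using ghost_witt_prod[OF p, of 0] by simp
  then show "(a \<otimes>\<^bsub>Witt p R\<^esub> b) 0 = a 0 \<otimes> b 0"
    by (simp add: Witt_mult eval_poly_times eval_poly_var case_sum_closed[OF ab])
qed (simp_all add: Witt_one)

section \<open>Multiplication by the characteristic\<close>

lemma (in ring_hom_ring) hom_add_pow:
  fixes n :: nat
  shows "x \<in> carrier R \<Longrightarrow> h ([n] \<cdot> x) = [n] \<cdot>\<^bsub>S\<^esub> h x"
  by (induction n) simp_all

lemma ghost_Witt_add_pow:
  fixes k :: nat
  assumes p: "Factorial_Ring.prime p"
  shows "ghost p ([k] \<cdot>\<^bsub>Witt p ZX\<^esub> a) n = of_nat k * ghost p a n"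
proof -
  interpret W: cring "Witt p ZX" by (rule cring_Witt_ZX[OF p])
  show ?thesis
    by (induction k)
       (simp_all add: ghost_Witt_add[OF p] ghost_Witt_zero prime_gt_0_nat[OF p] algebra_simps)
qed

definition verschiebung :: "('a, 'b) ring_scheme \<Rightarrow> (nat \<Rightarrow> 'a) \<Rightarrow> nat \<Rightarrow> 'a" where
  "verschiebung R a = case_nat \<zero>\<^bsub>R\<^esub> a"

lemma verschiebung_simps [simp]:
  "verschiebung R a 0 = \<zero>\<^bsub>R\<^esub>" "verschiebung R a (Suc n) = a n"
  by (simp_all add: verschiebung_def)

lemma ghost_verschiebung_Suc:
  assumes "p > 0"
  shows "ghost p (verschiebung ZX a) (Suc n) = of_nat p * ghost p a n"
  using assms
  by (simp add: ghost_def sum.atMost_Suc_shift zero_power sum_distrib_left mult.assoc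
      del: sum.atMost_Suc)

lemma prime_dvd_Witt_add_pow_diff:
  assumes p: "Factorial_Ring.prime p"
  shows "of_nat p dvd ([p] \<cdot>\<^bsub>Witt p ZX\<^esub> a) n - verschiebung ZX (\<lambda>i. a i ^ p) n"
proof (rule dvd_diff_if_ghost_diff_dvd)
  show p_pos: "p > 0" using p by (rule prime_gt_0_nat)
  have "of_nat p * ghost p a k =
      ghost p (verschiebung ZX (\<lambda>i. a i ^ p)) k + of_nat (p ^ Suc k) * a k" for k
    by (cases k)
       (simp_all add: ghost_verschiebung_Suc[OF p_pos] ghost_Suc[of p a] algebra_simps)
  then show "of_nat (p ^ Suc k) dvd
      ghost p ([p] \<cdot>\<^bsub>Witt p ZX\<^esub> a) k - ghost p (verschiebung ZX (\<lambda>i. a i ^ p)) k" for k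
    by (simp add: ghost_Witt_add_pow[OF p])
qed

lemma (in cring) Witt_add_pow_prime:
  assumes p: "Factorial_Ring.prime p" and char: "[p] \<cdot> \<one> = \<zero>"
    and a: "a \<in> carrier (Witt p R)"
  shows "[p] \<cdot>\<^bsub>Witt p R\<^esub> a = verschiebung R (\<lambda>i. a i [^] p)"
proof -
  obtain h A where h: "h \<in> ring_hom ZX R" and hA: "a = h \<circ> A"
    using witt_vectors_over_ZX[OF a a a] by metis
  interpret h: type_ring_hom R h by unfold_locales (rule h)
  interpret ring_hom_ring "Witt p ZX" "Witt p R" "(\<circ>) h"
    using cring.axioms(1)[OF cring_Witt_ZX[OF p]] cring.axioms(1)[OF cring_Witt[OF p]]
      ring_hom_comp_Witt[OF cring_ZX is_cring h]
    by (rule ring_hom_ringI2)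
  have "[p] \<cdot>\<^bsub>Witt p R\<^esub> a = h \<circ> [p] \<cdot>\<^bsub>Witt p ZX\<^esub> A"
    using hom_add_pow[of A p] by (simp add: hA)
  also have "\<dots> = h \<circ> verschiebung ZX (\<lambda>i. A i ^ p)"
    unfolding fun_eq_iff comp_apply
    by (intro allI h.eq_if_dvd_diff[OF char] prime_dvd_Witt_add_pow_diff[OF p])
  also have "\<dots> = verschiebung R (\<lambda>i. a i [^] p)"
    by (auto simp: fun_eq_iff verschiebung_def hA h.zero h.power split: nat.split)
  finally show ?thesis .
qed

lemma (in cring) power_add_prime_char:
  fixes p :: nat
  assumes p: "Factorial_Ring.prime p" and char: "[p] \<cdot> \<one> = \<zero>"
    and xy: "x \<in> carrier R" "y \<in> carrier R"
  shows "(x \<oplus> y) [^] p = x [^] p \<oplus> y [^] p"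
proof -
  let ?X = "poly_var (Inl 0)" and ?Y = "poly_var (Inr 0)"
  let ?e = "case_sum (\<lambda>_. x) (\<lambda>_. y)"
  have e: "?e v \<in> carrier R" for v
    using xy by (cases v) auto
  interpret h: type_ring_hom R "eval_poly R ?e"
    using e by (rule type_ring_hom_eval_poly)
  have "eval_poly R ?e ((?X + ?Y) ^ p) = eval_poly R ?e (?X ^ p + ?Y ^ p)"
    by (intro h.eq_if_dvd_diff[OF char] of_nat_prime_dvd_power_add p)
  then show ?thesis
    by (simp add: h.add h.power eval_poly_var e)
qed

locale semiperfect_ring = cring R for R :: "('a, 'b) ring_scheme" (structure) and p :: nat +
  assumes prime: "Factorial_Ring.prime p"
    and char: "[p] \<cdot> \<one> = \<zero>"
    and frobenius_surj: "(\<lambda>x. x [^] p) ` carrier R = carrier R"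

text \<open>The elements of \<open>W(R)\<close> whose component at \<open>0\<close> vanishes are the multiples of \<open>p\<close>.\<close>

lemma (in semiperfect_ring) Witt_eq_multiple_plus_power:
  assumes w: "w \<in> carrier (Witt p R)"
  obtains u v where "u \<in> carrier (Witt p R)" "v \<in> carrier (Witt p R)"
    "w = [p] \<cdot>\<^bsub>Witt p R\<^esub> v \<oplus>\<^bsub>Witt p R\<^esub> (u [^]\<^bsub>Witt p R\<^esub> p)"
proof -
  interpret W: cring "Witt p R" by (rule cring_Witt[OF prime])
  interpret component_0: ring_hom_ring "Witt p R" R "\<lambda>a. a 0"
    by (rule ring_hom_ringI2[OF W.ring_axioms ring_axioms Witt_component_0_ring_hom[OF prime]])
  define r where "r = inv_into (carrier R) (\<lambda>x. x [^] p)"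
  have r: "r x \<in> carrier R" "r x [^] p = x" if "x \<in> carrier R" for x
    using that inv_into_into[of x "\<lambda>x. x [^] p" "carrier R"]
      f_inv_into_f[of x "\<lambda>x. x [^] p" "carrier R"]
    by (simp_all only: frobenius_surj r_def)
  define u where "u = r \<circ> w"
  define y where "y = w \<ominus>\<^bsub>Witt p R\<^esub> u [^]\<^bsub>Witt p R\<^esub> p"
  define v where "v = (\<lambda>n. r (y (Suc n)))"
  have u: "u \<in> carrier (Witt p R)" using r w by (simp add: u_def)
  have y: "y \<in> carrier (Witt p R)"
    unfolding y_def using w u by (intro W.minus_closed W.nat_pow_closed)
  have v: "v \<in> carrier (Witt p R)" using r y by (simp add: v_def)
  have "(u [^]\<^bsub>Witt p R\<^esub> p) 0 = w 0"
    using component_0.hom_nat_pow[OF u] r w by (simp add: u_def)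
  then have "y 0 = \<zero>"
    unfolding y_def W.minus_eq
    using w u component_0.hom_add[OF w W.a_inv_closed[OF W.nat_pow_closed[OF u]]]
      component_0.hom_a_inv[OF W.nat_pow_closed[OF u]] by (simp add: r_neg)
  then have "[p] \<cdot>\<^bsub>Witt p R\<^esub> v = y"
    unfolding Witt_add_pow_prime[OF prime char v]
    using r y by (auto simp: fun_eq_iff v_def verschiebung_def split: nat.split)
  moreover have "w = y \<oplus>\<^bsub>Witt p R\<^esub> u [^]\<^bsub>Witt p R\<^esub> p"
    using w W.nat_pow_closed[OF u, of p] unfolding y_def by algebra
  ultimately show thesis using that[OF u v] by simp
qed

locale residue_field = field F for F :: "'a ring" (structure) and p :: nat +
  assumes prime: "Factorial_Ring.prime p"
    and char: "[p] \<cdot> \<one> = \<zero>"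
    and finite_carrier: "finite (carrier F)"
begin

lemma frobenius_inj: "inj_on (\<lambda>x. x [^] p) (carrier F)"
proof (rule inj_onI)
  fix x y assume xy: "x \<in> carrier F" "y \<in> carrier F" "x [^] p = y [^] p"
  have "x = y \<oplus> (x \<ominus> y)" using xy(1,2) by algebra
  then have "y [^] p \<oplus> (x \<ominus> y) [^] p = y [^] p"
    using power_add_prime_char[OF prime char, of y "x \<ominus> y"] xy by simp
  then have "(x \<ominus> y) [^] p = \<zero>"
    using xy by (metis add.l_cancel_one minus_closed nat_pow_closed)
  moreover have "a [^] k \<noteq> \<zero>" if "a \<in> carrier F" "a \<noteq> \<zero>" for a and k :: nat
    using that by (induction k) (auto simp: integral_iff)
  ultimately have "x \<ominus> y = \<zero>" using xy(1,2) by blast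
  then show "x = y" using xy(1,2) by simp
qed

sublocale semiperfect_ring F p
proof (unfold_locales, rule prime, rule char)
  show "(\<lambda>x. x [^] p) ` carrier F = carrier F"
    using finite_carrier frobenius_inj by (intro endo_inj_surj) auto
qed

end

section \<open>Coefficient rings\<close>

lemma (in cring) power_add_expansion:
  assumes ya: "y \<in> carrier R" "a \<in> carrier R"
  shows "\<exists>c\<in>carrier R. (y \<oplus> a) [^] Suc k =
    y [^] Suc k \<oplus> ([Suc k] \<cdot> \<one>) \<otimes> (y [^] k \<otimes> a) \<oplus> a \<otimes> a \<otimes> c"
proof (induction k)
  case 0
  show ?case using ya by (intro bexI[of _ \<zero>]) auto
next
  case (Suc k)
  then obtain c where c: "c \<in> carrier R" "(y \<oplus> a) [^] Suc k =
      y [^] Suc k \<oplus> ([Suc k] \<cdot> \<one>) \<otimes> (y [^] k \<otimes> a) \<oplus> a \<otimes> a \<otimes> c"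
    by blast
  define e z where "e = [Suc k] \<cdot> \<one>" and "z = y [^] k"
  have ez: "e \<in> carrier R" "z \<in> carrier R" using ya by (auto simp: e_def z_def)
  have "(y \<oplus> a) [^] Suc (Suc k) = (z \<otimes> y \<oplus> e \<otimes> (z \<otimes> a) \<oplus> a \<otimes> a \<otimes> c) \<otimes> (y \<oplus> a)"
    using c(2) by (simp add: e_def z_def)
  also have "\<dots> = z \<otimes> y \<otimes> y \<oplus> (e \<oplus> \<one>) \<otimes> (z \<otimes> y \<otimes> a) \<oplus>
      a \<otimes> a \<otimes> (e \<otimes> z \<oplus> c \<otimes> (y \<oplus> a))"
    using ez c(1) ya by algebra
  finally show ?case
    using ez c(1) ya by (intro bexI[of _ "e \<otimes> z \<oplus> c \<otimes> (y \<oplus> a)"]) (auto simp: e_def z_def)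
qed

lemma (in cring) finite_Units_power_eq_one:
  assumes "finite (carrier R)" and x: "x \<in> Units R"
  obtains k :: nat where "x [^] Suc k = \<one>"
proof -
  have fin: "finite (Units R)" using assms(1) by (rule finite_ring_finite_units)
  then have "card (Units R) > 0" using x by (auto simp: card_gt_0_iff)
  then obtain k where "card (Units R) = Suc k" by (cases "card (Units R)") auto
  then show thesis using that units_power_order_eq_one[OF fin x] by metis
qed

lemma mem_a_kernel_iff: "x \<in> a_kernel R S h \<longleftrightarrow> x \<in> carrier R \<and> h x = \<zero>\<^bsub>S\<^esub>"
  unfolding a_kernel_def' by (rule mem_Collect_eq)

lemma (in ring_hom_cring) maximalideal_kernel_finite_field:
  assumes S: "field S" "finite (carrier S)"
  shows "maximalideal (a_kernel R S h) R"
proof (rule maximalidealI)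
  interpret S: field S by fact
  show "ideal (a_kernel R S h) R" by (rule ring.kernel_is_ideal)
  show "carrier R \<noteq> a_kernel R S h"
    using mem_a_kernel_iff[of "\<one>\<^bsub>R\<^esub>" R S h] ring.hom_one S.one_not_zero R.one_closed by metis
  fix J assume J: "ideal J R" "a_kernel R S h \<subseteq> J" "J \<subseteq> carrier R"
  interpret J: ideal J R by fact
  show "J = a_kernel R S h \<or> J = carrier R"
  proof (cases "J \<subseteq> a_kernel R S h")
    case False
    then obtain x where xJ: "x \<in> J" "x \<notin> a_kernel R S h" by blast
    then have x: "x \<in> J" "x \<in> carrier R" using J(3) by auto
    then have hx: "h x \<in> Units S"
      unfolding S.field_Units
      using xJ(2) ring.hom_closed[OF x(2)] mem_a_kernel_iff[of x R S h] by blast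
    obtain k :: nat where k: "h x [^]\<^bsub>S\<^esub> Suc k = \<one>\<^bsub>S\<^esub>"
      using S.finite_Units_power_eq_one[OF assms(2) hx] .
    define z where "z = x [^]\<^bsub>R\<^esub> Suc k"
    have z: "z \<in> carrier R" "z \<in> J"
      using x by (simp_all add: z_def J.I_l_closed)
    have "h z = \<one>\<^bsub>S\<^esub>"
      using ring.hom_nat_pow[OF x(2), of "Suc k"] by (simp only: z_def k)
    then have "\<one>\<^bsub>R\<^esub> \<ominus>\<^bsub>R\<^esub> z \<in> J"
      using z(1) by (intro subsetD[OF J(2)])
        (simp add: mem_a_kernel_iff a_minus_def S.r_neg del: ring.kernel_zero)
    then have "(\<one>\<^bsub>R\<^esub> \<ominus>\<^bsub>R\<^esub> z) \<oplus>\<^bsub>R\<^esub> z \<in> J"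
      using z(2) by (rule J.a_closed)
    then have "\<one>\<^bsub>R\<^esub> \<in> J"
      using z(1) by (simp add: R.minus_eq R.a_assoc R.l_neg)
    then show ?thesis using J.one_imp_carrier by simp
  qed (use J(2) in blast)
qed

locale residue_map = cring R + F: cring F
  for R :: "'a calg" (structure) and F :: "'a ring" +
  assumes red_hom: "red R \<in> ring_hom R F"
begin

sublocale red: ring_hom_ring R F "red R"
  by (rule ring_hom_ringI2[OF ring_axioms F.ring_axioms red_hom])

lemma max_ideal_iff: "x \<in> max_ideal F R \<longleftrightarrow> x \<in> carrier R \<and> red R x = \<zero>\<^bsub>F\<^esub>"
  by (simp add: max_ideal_def mem_a_kernel_iff del: red.kernel_zero)

lemma red_eq_iff:
  assumes "x \<in> carrier R" "y \<in> carrier R"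
  shows "red R x = red R y \<longleftrightarrow> x \<ominus> y \<in> max_ideal F R"
proof -
  have "red R (x \<ominus> y) = red R x \<ominus>\<^bsub>F\<^esub> red R y"
    using assms by (simp add: a_minus_def)
  then show ?thesis using assms by (simp add: max_ideal_iff)
qed

lemma max_ideal_ideal: "ideal (max_ideal F R) R"
  unfolding max_ideal_def by (rule red.kernel_is_ideal)

lemma max_ideal_pow_0: "max_ideal_pow F R 0 = carrier R"
  by (simp add: max_ideal_pow_def ideals_set_def nat_pow_def)

lemma max_ideal_pow_Suc:
  "max_ideal_pow F R (Suc n) = ideal_prod R (max_ideal_pow F R n) (max_ideal F R)"
  by (simp add: max_ideal_pow_def ideals_set_def nat_pow_def)

lemma max_ideal_pow_ideal: "ideal (max_ideal_pow F R n) R"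
  by (induction n)
     (auto simp: max_ideal_pow_0 max_ideal_pow_Suc
       intro: oneideal ideal_prod_is_ideal max_ideal_ideal)

lemma max_ideal_pow_Suc_subset:
  "max_ideal_pow F R (Suc n) \<subseteq> max_ideal_pow F R n \<inter> max_ideal F R"
  unfolding max_ideal_pow_Suc
  by (intro ideal_prod_inter max_ideal_pow_ideal max_ideal_ideal)

lemma mult_in_max_ideal_pow_Suc:
  "a \<in> max_ideal_pow F R n \<Longrightarrow> b \<in> max_ideal F R \<Longrightarrow> a \<otimes> b \<in> max_ideal_pow F R (Suc n)"
  unfolding max_ideal_pow_Suc by (rule ideal_prod.prod)

lemma max_ideal_subset_pow_1: "max_ideal F R \<subseteq> max_ideal_pow F R (Suc 0)"
proof
  fix x assume x: "x \<in> max_ideal F R"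
  then have "\<one> \<otimes> x \<in> max_ideal_pow F R (Suc 0)"
    by (intro mult_in_max_ideal_pow_Suc) (simp_all add: max_ideal_pow_0)
  then show "x \<in> max_ideal_pow F R (Suc 0)"
    using x by (simp add: max_ideal_iff)
qed

lemma of_nat_in_max_ideal:
  fixes n :: nat
  assumes "[n] \<cdot>\<^bsub>F\<^esub> \<one>\<^bsub>F\<^esub> = \<zero>\<^bsub>F\<^esub>"
  shows "[n] \<cdot> \<one> \<in> max_ideal F R"
  using red.hom_add_pow[of \<one> n] assms by (simp add: max_ideal_iff)

lemma power_diff_in_max_ideal_pow:
  fixes n :: nat
  assumes n: "[n] \<cdot> \<one> \<in> max_ideal F R" "n > 0"
    and xy: "x \<in> carrier R" "y \<in> carrier R" "x \<ominus> y \<in> max_ideal_pow F R (Suc m)"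
  shows "x [^] n \<ominus> y [^] n \<in> max_ideal_pow F R (Suc (Suc m))"
proof -
  interpret J: ideal "max_ideal_pow F R (Suc (Suc m))" R by (rule max_ideal_pow_ideal)
  obtain k where k: "n = Suc k" using n(2) by (cases n) auto
  define a e where "a = x \<ominus> y" and "e = [n] \<cdot> \<one>"
  have a: "a \<in> carrier R" "a \<in> max_ideal_pow F R (Suc m)" "a \<in> max_ideal F R"
    using xy max_ideal_pow_Suc_subset[of m] by (auto simp: a_def)
  have e: "e \<in> carrier R" "e \<in> max_ideal F R" using n by (simp_all add: e_def)
  have "x = y \<oplus> a" unfolding a_def using xy by algebra
  then obtain c where c: "c \<in> carrier R"
      "x [^] n = y [^] n \<oplus> e \<otimes> (y [^] k \<otimes> a) \<oplus> a \<otimes> a \<otimes> c"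
    using power_add_expansion[OF xy(2) a(1), of k] unfolding k e_def by blast
  have "x [^] n \<ominus> y [^] n = y [^] k \<otimes> (a \<otimes> e) \<oplus> c \<otimes> (a \<otimes> a)"
    unfolding c(2) using c(1) e a(1) nat_pow_closed[OF xy(2), of k] nat_pow_closed[OF xy(2), of n]
    by algebra
  also have "\<dots> \<in> max_ideal_pow F R (Suc (Suc m))"
    using a e c(1) xy(2) by (intro J.a_closed J.I_l_closed mult_in_max_ideal_pow_Suc) auto
  finally show ?thesis .
qed

lemma multiple_plus_power_diff_in_max_ideal_pow:
  fixes n :: nat
  assumes n: "[n] \<cdot>\<^bsub>F\<^esub> \<one>\<^bsub>F\<^esub> = \<zero>\<^bsub>F\<^esub>" "n > 0"
    and xy: "x \<in> carrier R" "y \<in> carrier R" "x \<ominus> y \<in> max_ideal_pow F R (Suc m)"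
    and uv: "u \<in> carrier R" "v \<in> carrier R" "u \<ominus> v \<in> max_ideal_pow F R (Suc m)"
  shows "([n] \<cdot> x \<oplus> u [^] n) \<ominus> ([n] \<cdot> y \<oplus> v [^] n) \<in> max_ideal_pow F R (Suc (Suc m))"
proof -
  interpret J: ideal "max_ideal_pow F R (Suc (Suc m))" R by (rule max_ideal_pow_ideal)
  define e where "e = [n] \<cdot> \<one>"
  have e: "e \<in> carrier R" "e \<in> max_ideal F R"
    using of_nat_in_max_ideal[OF n(1)] by (simp_all add: e_def)
  have multiple: "[n] \<cdot> z = z \<otimes> e" if "z \<in> carrier R" for z
    using that by (simp add: e_def add_pow_rdistr)
  have "([n] \<cdot> x \<oplus> u [^] n) \<ominus> ([n] \<cdot> y \<oplus> v [^] n) = (x \<ominus> y) \<otimes> e \<oplus> (u [^] n \<ominus> v [^] n)"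
    unfolding multiple[OF xy(1)] multiple[OF xy(2)]
    using xy uv e(1) nat_pow_closed[OF uv(1), of n] nat_pow_closed[OF uv(2), of n] by algebra
  also have "\<dots> \<in> max_ideal_pow F R (Suc (Suc m))"
    using xy uv e n(2) unfolding e_def
    by (intro J.a_closed mult_in_max_ideal_pow_Suc power_diff_in_max_ideal_pow)
  finally show ?thesis .
qed

lemma Witt_hom_diff_in_max_ideal_pow:
  assumes F: "semiperfect_ring F p"
    and h: "h \<in> ring_hom (Witt p F) R" and h': "h' \<in> ring_hom (Witt p F) R"
    and red: "\<And>w. w \<in> carrier (Witt p F) \<Longrightarrow> red R (h w) = red R (h' w)"
  shows "w \<in> carrier (Witt p F) \<Longrightarrow> h w \<ominus> h' w \<in> max_ideal_pow F R (Suc n)"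
proof (induction n arbitrary: w)
  case 0
  then have "h w \<ominus> h' w \<in> max_ideal F R"
    using red[OF 0] ring_hom_closed[OF h 0] ring_hom_closed[OF h' 0] red_eq_iff by simp
  then show ?case using max_ideal_subset_pow_1 by blast
next
  case (Suc n)
  interpret F: semiperfect_ring F p by fact
  interpret W: cring "Witt p F" by (rule F.cring_Witt[OF F.prime])
  obtain u v where uv: "u \<in> carrier (Witt p F)" "v \<in> carrier (Witt p F)"
    and w: "w = [p] \<cdot>\<^bsub>Witt p F\<^esub> v \<oplus>\<^bsub>Witt p F\<^esub> (u [^]\<^bsub>Witt p F\<^esub> p)"
    using F.Witt_eq_multiple_plus_power[OF Suc.prems] by metis
  have hom_w: "g w = [p] \<cdot> g v \<oplus> g u [^] p" if g: "g \<in> ring_hom (Witt p F) R" for g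
  proof -
    interpret g: ring_hom_ring "Witt p F" R g
      by (rule ring_hom_ringI2[OF W.ring_axioms ring_axioms g])
    show ?thesis
      unfolding w using uv
      by (simp only: g.hom_add g.hom_add_pow g.hom_nat_pow W.add.nat_pow_closed W.nat_pow_closed)
  qed
  show ?case
    unfolding hom_w[OF h] hom_w[OF h']
    using F.char prime_gt_0_nat[OF F.prime] Suc.IH uv
    by (intro multiple_plus_power_diff_in_max_ideal_pow ring_hom_closed[OF h] ring_hom_closed[OF h'])
qed

end

locale coefficient_ring = residue_map R F + F: residue_field F p
  for R :: "'a calg" (structure) and F :: "'a ring" and p :: nat +
  assumes coeff_ring: "coeff_ring p F R"
begin

lemma str_hom: "str R \<in> ring_hom (Witt p F) R"
  using coeff_ring by (simp add: coeff_ring_def)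

lemma red_surj: "red R ` carrier R = carrier F"
  using coeff_ring by (simp add: coeff_ring_def)

lemma maximalideal_unique: "maximalideal I R \<Longrightarrow> maximalideal J R \<Longrightarrow> I = J"
  using coeff_ring unfolding coeff_ring_def by blast

lemma max_ideal_pow_inter: "(\<Inter>n. max_ideal_pow F R n) = {\<zero>}"
  using coeff_ring by (simp add: coeff_ring_def adically_complete_def)

lemma Witt_hom_unique:
  assumes h: "h \<in> ring_hom (Witt p F) R" and h': "h' \<in> ring_hom (Witt p F) R"
    and red: "\<And>w. w \<in> carrier (Witt p F) \<Longrightarrow> red R (h w) = red R (h' w)"
    and w: "w \<in> carrier (Witt p F)"
  shows "h w = h' w"
proof -
  have closed: "h w \<in> carrier R" "h' w \<in> carrier R"
    using ring_hom_closed[OF h w] ring_hom_closed[OF h' w] by auto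
  have "h w \<ominus> h' w \<in> max_ideal_pow F R n" for n
    using Witt_hom_diff_in_max_ideal_pow[OF F.semiperfect_ring_axioms h h' red w, of n]
      max_ideal_pow_Suc_subset[of n] by blast
  then have "h w \<ominus> h' w = \<zero>"
    using max_ideal_pow_inter by blast
  then show ?thesis using closed by simp
qed

end

lemma (in residue_field) coefficient_ringI:
  "coeff_ring p F R \<Longrightarrow> coefficient_ring R F p"
  by (intro coefficient_ring.intro residue_map.intro residue_map_axioms.intro
      coefficient_ring_axioms.intro is_cring residue_field_axioms)
     (simp_all add: coeff_ring_def)

locale coefficient_ring_hom = R: coefficient_ring R F p + S: coefficient_ring S F p
  for R S :: "'a calg" and F :: "'a ring" and p :: nat +
  fixes f :: "'a \<Rightarrow> 'a"
  assumes ring_hom: "f \<in> ring_hom R S"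
begin

sublocale ring_hom_ring R S f
  by (rule ring_hom_ringI2[OF R.ring_axioms S.ring_axioms ring_hom])

text \<open>Two homomorphisms to a finite field have maximal kernels, which agree in a local ring.\<close>

lemma max_ideal_image_iff:
  assumes x: "x \<in> carrier R"
  shows "f x \<in> max_ideal F S \<longleftrightarrow> x \<in> max_ideal F R"
proof -
  have maximal: "maximalideal (a_kernel R F g) R" if "g \<in> ring_hom R F" for g
  proof -
    interpret g: ring_hom_cring R F g
      by (intro ring_hom_cringI ring_hom_ringI2 R.ring_axioms R.F.ring_axioms R.is_cring
          R.F.is_cring that)
    show ?thesis
      using R.F.field_axioms R.F.finite_carrier by (rule g.maximalideal_kernel_finite_field)
  qed
  have "a_kernel R F (red S \<circ> f) = max_ideal F R"
    unfolding max_ideal_def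
    using ring_hom_trans[OF ring_hom S.red_hom] R.red_hom
    by (intro R.maximalideal_unique maximal)
  then show ?thesis
    using x hom_closed[OF x] mem_a_kernel_iff[of x R F "red S \<circ> f"] by (simp add: S.max_ideal_iff)
qed

lemma red_image_eq_iff:
  assumes xy: "x \<in> carrier R" "y \<in> carrier R"
  shows "red S (f x) = red S (f y) \<longleftrightarrow> red R x = red R y"
proof -
  have "f (x \<ominus>\<^bsub>R\<^esub> y) = f x \<ominus>\<^bsub>S\<^esub> f y"
    using xy by (simp add: a_minus_def)
  then show ?thesis
    using xy max_ideal_image_iff[of "x \<ominus>\<^bsub>R\<^esub> y"] R.red_eq_iff[OF xy]
      S.red_eq_iff[OF hom_closed hom_closed, OF xy] by simp
qed

end

lemma ring_hom_funpow: "f \<in> ring_hom R R \<Longrightarrow> f ^^ n \<in> ring_hom R R"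
proof (induction n)
  case 0
  show ?case by (auto simp: ring_hom_def)
next
  case (Suc n)
  then show ?case using ring_hom_trans[of "f ^^ n" R R f R] by (simp only: funpow.simps)
qed

lemma (in coefficient_ring) coefficient_ring_homI:
  "coefficient_ring S F p \<Longrightarrow> f \<in> ring_hom R S \<Longrightarrow> coefficient_ring_hom R S F p f"
  by (intro coefficient_ring_hom.intro coefficient_ring_hom_axioms.intro coefficient_ring_axioms)

text \<open>The powers of \<open>f\<close> induce injective maps \<open>F \<rightarrow> F\<close>, two of which coincide.\<close>

lemma (in coefficient_ring) endo_funpow_residually_trivial:
  assumes f: "f \<in> ring_hom R R"
  obtains n where "n > 0" "\<And>x. x \<in> carrier R \<Longrightarrow> red R ((f ^^ n) x) = red R x"
proof -
  note funpow_hom = coefficient_ring_homI[OF coefficient_ring_axioms ring_hom_funpow[OF f]]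
  define s where "s = inv_into (carrier R) (red R)"
  have s: "s y \<in> carrier R" "red R (s y) = y" if "y \<in> carrier F" for y
    using that inv_into_into[of y "red R"] f_inv_into_f[of y "red R"]
    by (simp_all add: s_def red_surj)
  define \<sigma> where "\<sigma> n = (\<lambda>y\<in>carrier F. red R ((f ^^ n) (s y)))" for n
  have red_funpow: "red R ((f ^^ n) x) = \<sigma> n (red R x)" if "x \<in> carrier R" for n x
    using that s[of "red R x"] coefficient_ring_hom.red_image_eq_iff[OF funpow_hom, of x "s (red R x)"]
    by (simp add: \<sigma>_def)
  have "range \<sigma> \<subseteq> carrier F \<rightarrow>\<^sub>E carrier F"
    using s(1) ring_hom_closed[OF ring_hom_funpow[OF f]] by (auto simp: \<sigma>_def)
  then have "\<not> inj \<sigma>"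
    using finite_PiE[OF F.finite_carrier F.finite_carrier] finite_subset range_inj_infinite by metis
  then obtain i d where d: "d > 0" "\<sigma> (i + d) = \<sigma> i"
    by (metis injI less_imp_add_positive linorder_neqE_nat)
  show thesis
  proof (rule that[OF d(1)])
    fix x assume x: "x \<in> carrier R"
    have "red R ((f ^^ i) ((f ^^ d) x)) = red R ((f ^^ i) x)"
      using red_funpow[OF x, of "i + d"] red_funpow[OF x, of i] d(2) by (simp add: funpow_add)
    then show "red R ((f ^^ d) x) = red R x"
      using coefficient_ring_hom.red_image_eq_iff[OF funpow_hom] x
        ring_hom_closed[OF ring_hom_funpow[OF f]] by blast
  qed
qed

lemma (in coefficient_ring) residually_trivial_endo_calg_hom:
  assumes f: "f \<in> ring_hom R R" and red: "\<And>x. x \<in> carrier R \<Longrightarrow> red R (f x) = red R x"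
  shows "restrict f (carrier R) \<in> calg_hom p F R R"
proof -
  have "(f \<circ> str R) w = str R w" if "w \<in> carrier (Witt p F)" for w
    using red ring_hom_closed[OF str_hom]
    by (intro Witt_hom_unique[OF ring_hom_trans[OF str_hom f] str_hom _ that]) simp
  moreover have "restrict f (carrier R) \<in> ring_hom R R"
    using f by (auto simp: ring_hom_def)
  ultimately show ?thesis
    using red ring_hom_closed[OF str_hom] ring_hom_closed[OF f]
    by (auto simp: calg_hom_def max_ideal_iff)
qed

section \<open>Two by two matrices\<close>

lemma GL2_mult: "A \<otimes>\<^bsub>GL2 R\<^esub> B = Mat2
    (m11 A \<otimes>\<^bsub>R\<^esub> m11 B \<oplus>\<^bsub>R\<^esub> m12 A \<otimes>\<^bsub>R\<^esub> m21 B) (m11 A \<otimes>\<^bsub>R\<^esub> m12 B \<oplus>\<^bsub>R\<^esub> m12 A \<otimes>\<^bsub>R\<^esub> m22 B)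
    (m21 A \<otimes>\<^bsub>R\<^esub> m11 B \<oplus>\<^bsub>R\<^esub> m22 A \<otimes>\<^bsub>R\<^esub> m21 B) (m21 A \<otimes>\<^bsub>R\<^esub> m12 B \<oplus>\<^bsub>R\<^esub> m22 A \<otimes>\<^bsub>R\<^esub> m22 B)"
  by (simp add: GL2_def)

lemma GL2_one: "\<one>\<^bsub>GL2 R\<^esub> = Mat2 \<one>\<^bsub>R\<^esub> \<zero>\<^bsub>R\<^esub> \<zero>\<^bsub>R\<^esub> \<one>\<^bsub>R\<^esub>"
  by (simp add: GL2_def)

lemma Mat2_in_GL2_iff: "Mat2 a b c d \<in> carrier (GL2 R) \<longleftrightarrow>
    a \<in> carrier R \<and> b \<in> carrier R \<and> c \<in> carrier R \<and> d \<in> carrier R \<and>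
    a \<otimes>\<^bsub>R\<^esub> d \<ominus>\<^bsub>R\<^esub> b \<otimes>\<^bsub>R\<^esub> c \<in> Units R"
  by (auto simp: GL2_def det2_def)

lemma (in cring) det2_mult:
  assumes "set_mat2 A \<subseteq> carrier R" "set_mat2 B \<subseteq> carrier R"
  shows "det2 R (A \<otimes>\<^bsub>GL2 R\<^esub> B) = det2 R A \<otimes> det2 R B"
proof (cases A; cases B)
  fix a b c d a' b' c' d'
  assume AB: "A = Mat2 a b c d" "B = Mat2 a' b' c' d'"
  then have "a \<in> carrier R" "b \<in> carrier R" "c \<in> carrier R" "d \<in> carrier R"
    "a' \<in> carrier R" "b' \<in> carrier R" "c' \<in> carrier R" "d' \<in> carrier R"
    using assms by auto
  then have "(a \<otimes> a' \<oplus> b \<otimes> c') \<otimes> (c \<otimes> b' \<oplus> d \<otimes> d') \<ominus> (a \<otimes> b' \<oplus> b \<otimes> d') \<otimes> (c \<otimes> a' \<oplus> d \<otimes> c') =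
      (a \<otimes> d \<ominus> b \<otimes> c) \<otimes> (a' \<otimes> d' \<ominus> b' \<otimes> c')"
    by algebra
  then show ?thesis by (simp add: AB det2_def GL2_mult)
qed

lemma (in cring) GL2_mult_closed:
  assumes "A \<in> carrier (GL2 R)" "B \<in> carrier (GL2 R)"
  shows "A \<otimes>\<^bsub>GL2 R\<^esub> B \<in> carrier (GL2 R)"
proof -
  have AB: "set_mat2 A \<subseteq> carrier R" "set_mat2 B \<subseteq> carrier R"
    "det2 R A \<in> Units R" "det2 R B \<in> Units R"
    using assms by (simp_all add: GL2_def)
  then have "det2 R (A \<otimes>\<^bsub>GL2 R\<^esub> B) \<in> Units R"
    by (simp add: det2_mult)
  moreover have "set_mat2 (A \<otimes>\<^bsub>GL2 R\<^esub> B) \<subseteq> carrier R"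
    using AB(1,2) by (cases A; cases B) (auto simp: GL2_mult)
  ultimately show ?thesis by (simp add: GL2_def)
qed

lemma (in cring) GL2_left_inverse:
  assumes A: "A \<in> carrier (GL2 R)"
  shows "\<exists>B\<in>carrier (GL2 R). B \<otimes>\<^bsub>GL2 R\<^esub> A = \<one>\<^bsub>GL2 R\<^esub>"
proof (cases A)
  case (Mat2 a b c d)
  define e where "e = inv (a \<otimes> d \<ominus> b \<otimes> c)"
  have closed: "a \<in> carrier R" "b \<in> carrier R" "c \<in> carrier R" "d \<in> carrier R"
    and unit: "a \<otimes> d \<ominus> b \<otimes> c \<in> Units R"
    using A by (auto simp: Mat2 Mat2_in_GL2_iff)
  have e: "e \<in> carrier R" "e \<in> Units R" "e \<otimes> (a \<otimes> d \<ominus> b \<otimes> c) = \<one>"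
    using unit by (auto simp: e_def)
  let ?B = "Mat2 (e \<otimes> d) (e \<otimes> \<ominus> b) (e \<otimes> \<ominus> c) (e \<otimes> a)"
  have "e \<otimes> d \<otimes> (e \<otimes> a) \<ominus> e \<otimes> \<ominus> b \<otimes> (e \<otimes> \<ominus> c) = e \<otimes> (e \<otimes> (a \<otimes> d \<ominus> b \<otimes> c))"
    using closed e(1) by algebra
  then have "?B \<in> carrier (GL2 R)"
    using closed e by (simp add: Mat2_in_GL2_iff)
  moreover have "e \<otimes> d \<otimes> a \<oplus> e \<otimes> \<ominus> b \<otimes> c = e \<otimes> (a \<otimes> d \<ominus> b \<otimes> c)"
    "e \<otimes> d \<otimes> b \<oplus> e \<otimes> \<ominus> b \<otimes> d = \<zero>"
    "e \<otimes> \<ominus> c \<otimes> a \<oplus> e \<otimes> a \<otimes> c = \<zero>"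
    "e \<otimes> \<ominus> c \<otimes> b \<oplus> e \<otimes> a \<otimes> d = e \<otimes> (a \<otimes> d \<ominus> b \<otimes> c)"
    using closed e(1) by algebra+
  then have "?B \<otimes>\<^bsub>GL2 R\<^esub> A = \<one>\<^bsub>GL2 R\<^esub>"
    by (simp add: GL2_mult GL2_one Mat2 e(3))
  ultimately show ?thesis by blast
qed

lemma (in cring) GL2_group: "group (GL2 R)"
proof (rule groupI)
  show "\<one>\<^bsub>GL2 R\<^esub> \<in> carrier (GL2 R)"
    by (simp add: GL2_one Mat2_in_GL2_iff a_minus_def)
next
  fix A B C
  assume "A \<in> carrier (GL2 R)" "B \<in> carrier (GL2 R)" "C \<in> carrier (GL2 R)"
  then show "A \<otimes>\<^bsub>GL2 R\<^esub> B \<otimes>\<^bsub>GL2 R\<^esub> C = A \<otimes>\<^bsub>GL2 R\<^esub> (B \<otimes>\<^bsub>GL2 R\<^esub> C)"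
    by (cases A; cases B; cases C)
       (auto simp: GL2_mult Mat2_in_GL2_iff l_distr r_distr m_assoc a_ac)
next
  fix A assume "A \<in> carrier (GL2 R)"
  then show "\<one>\<^bsub>GL2 R\<^esub> \<otimes>\<^bsub>GL2 R\<^esub> A = A"
    by (cases A) (simp add: GL2_mult GL2_one Mat2_in_GL2_iff)
qed (simp_all add: GL2_mult_closed GL2_left_inverse)

lemma (in cring) tr2_closed: "A \<in> carrier (GL2 R) \<Longrightarrow> tr2 R A \<in> carrier R"
  by (cases A) (simp add: tr2_def Mat2_in_GL2_iff)

lemma (in cring) tr2_mult_commute:
  assumes "A \<in> carrier (GL2 R)" "B \<in> carrier (GL2 R)"
  shows "tr2 R (A \<otimes>\<^bsub>GL2 R\<^esub> B) = tr2 R (B \<otimes>\<^bsub>GL2 R\<^esub> A)"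
  using assms
  by (cases A; cases B) (auto simp: tr2_def GL2_mult Mat2_in_GL2_iff m_comm a_ac)

lemma (in cring) tr2_conjugate:
  assumes U: "U \<in> carrier (GL2 R)" and A: "A \<in> carrier (GL2 R)"
  shows "tr2 R (U \<otimes>\<^bsub>GL2 R\<^esub> A \<otimes>\<^bsub>GL2 R\<^esub> inv\<^bsub>GL2 R\<^esub> U) = tr2 R A"
proof -
  interpret GL: group "GL2 R" by (rule GL2_group)
  have "tr2 R (U \<otimes>\<^bsub>GL2 R\<^esub> A \<otimes>\<^bsub>GL2 R\<^esub> inv\<^bsub>GL2 R\<^esub> U) =
      tr2 R (inv\<^bsub>GL2 R\<^esub> U \<otimes>\<^bsub>GL2 R\<^esub> (U \<otimes>\<^bsub>GL2 R\<^esub> A))"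
    using U A by (intro tr2_mult_commute) auto
  then show ?thesis using U A by (simp add: GL.m_assoc[symmetric])
qed

lemma (in ring_hom_cring) hom_Units:
  assumes x: "x \<in> Units R"
  shows "h x \<in> Units S"
proof -
  have closed: "h x \<in> carrier S" "h (inv\<^bsub>R\<^esub> x) \<in> carrier S"
    using R.Units_closed[OF x] R.Units_inv_closed[OF x] by simp_all
  have "h (inv\<^bsub>R\<^esub> x) \<otimes>\<^bsub>S\<^esub> h x = h (inv\<^bsub>R\<^esub> x \<otimes>\<^bsub>R\<^esub> x)"
    using x by (simp only: ring.hom_mult R.Units_inv_closed R.Units_closed)
  also have "\<dots> = \<one>\<^bsub>S\<^esub>"
    using x by simp
  finally show ?thesis
    using closed S.m_comm[OF closed] unfolding Units_def by auto
qed

lemma map_mat2_GL2_group_hom: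
  assumes R: "cring R" and S: "cring S" and f: "f \<in> ring_hom R S"
  shows "group_hom (GL2 R) (GL2 S) (map_mat2 f)"
proof (intro group_hom.intro group_hom_axioms.intro cring.GL2_group R S homI)
  interpret f: ring_hom_cring R S f
    by (intro ring_hom_cringI ring_hom_ringI2 cring.axioms(1) R S f)
  fix A assume A: "A \<in> carrier (GL2 R)"
  show "map_mat2 f A \<in> carrier (GL2 S)"
  proof (cases A)
    case (Mat2 a b c d)
    then have closed: "a \<in> carrier R" "b \<in> carrier R" "c \<in> carrier R" "d \<in> carrier R"
      and unit: "a \<otimes>\<^bsub>R\<^esub> d \<ominus>\<^bsub>R\<^esub> b \<otimes>\<^bsub>R\<^esub> c \<in> Units R"
      using A by (auto simp: Mat2_in_GL2_iff)
    have "f (a \<otimes>\<^bsub>R\<^esub> d \<ominus>\<^bsub>R\<^esub> b \<otimes>\<^bsub>R\<^esub> c) = f a \<otimes>\<^bsub>S\<^esub> f d \<ominus>\<^bsub>S\<^esub> f b \<otimes>\<^bsub>S\<^esub> f c"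
      using closed by (simp add: a_minus_def)
    with f.hom_Units[OF unit] show ?thesis
      using closed by (simp add: Mat2 Mat2_in_GL2_iff)
  qed
  fix B assume "B \<in> carrier (GL2 R)"
  with A show "map_mat2 f (A \<otimes>\<^bsub>GL2 R\<^esub> B) = map_mat2 f A \<otimes>\<^bsub>GL2 S\<^esub> map_mat2 f B"
    by (cases A; cases B) (simp add: GL2_mult Mat2_in_GL2_iff)
qed

lemma tr2_map_mat2:
  assumes f: "f \<in> ring_hom R S" and A: "A \<in> carrier (GL2 R)"
  shows "tr2 S (map_mat2 f A) = f (tr2 R A)"
  using A ring_hom_add[OF f] by (cases A) (simp add: tr2_def Mat2_in_GL2_iff)

lemma map_mat2_restrict:
  "A \<in> carrier (GL2 R) \<Longrightarrow> map_mat2 (restrict f (carrier R)) A = map_mat2 f A"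
  by (cases A) (simp add: Mat2_in_GL2_iff)

section \<open>Strict equivalence\<close>

definition GL2_congruence_subgroup :: "'a ring \<Rightarrow> 'a calg \<Rightarrow> 'a mat2 set" where
  "GL2_congruence_subgroup F R = kernel (GL2 R) (GL2 F) (map_mat2 (red R))"

lemma strictly_equivalent_iff:
  "strictly_equivalent K F R \<rho> \<rho>' \<longleftrightarrow>
    (\<exists>U\<in>GL2_congruence_subgroup F R.
      \<forall>g\<in>carrier (Gal K). \<rho>' g = U \<otimes>\<^bsub>GL2 R\<^esub> \<rho> g \<otimes>\<^bsub>GL2 R\<^esub> inv\<^bsub>GL2 R\<^esub> U)"
  by (auto simp: strictly_equivalent_def GL2_congruence_subgroup_def kernel_def)

lemma strictly_equivalent_cong:
  assumes "\<And>g. g \<in> carrier (Gal K) \<Longrightarrow> \<sigma> g = \<rho> g"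
  shows "strictly_equivalent K F R \<sigma> \<rho>' \<longleftrightarrow> strictly_equivalent K F R \<rho> \<rho>'"
  using assms unfolding strictly_equivalent_def by simp

lemma deformation_closed:
  "deformation K F \<rho>bar R \<rho> \<Longrightarrow> \<rho> \<in> carrier (Gal K) \<rightarrow> carrier (GL2 R)"
  by (auto simp: deformation_def galois_rep_def hom_def)

context residue_map
begin

lemma subgroup_GL2_congruence: "subgroup (GL2_congruence_subgroup F R) (GL2 R)"
  unfolding GL2_congruence_subgroup_def
  by (rule group_hom.subgroup_kernel[OF map_mat2_GL2_group_hom[OF is_cring F.is_cring red_hom]])

lemma strictly_equivalent_refl:
  assumes \<rho>: "\<rho> \<in> carrier (Gal K) \<rightarrow> carrier (GL2 R)"
  shows "strictly_equivalent K F R \<rho> \<rho>"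
proof -
  interpret GL: group "GL2 R" by (rule GL2_group)
  show ?thesis
    unfolding strictly_equivalent_iff
    using funcset_mem[OF \<rho>] subgroup.one_closed[OF subgroup_GL2_congruence]
    by (intro bexI[of _ "\<one>\<^bsub>GL2 R\<^esub>"]) auto
qed

lemma strictly_equivalent_trans:
  assumes \<rho>: "\<rho> \<in> carrier (Gal K) \<rightarrow> carrier (GL2 R)"
    and eq: "strictly_equivalent K F R \<rho> \<rho>'" "strictly_equivalent K F R \<rho>' \<rho>''"
  shows "strictly_equivalent K F R \<rho> \<rho>''"
proof -
  interpret GL: group "GL2 R" by (rule GL2_group)
  interpret \<Gamma>: subgroup "GL2_congruence_subgroup F R" "GL2 R" by (rule subgroup_GL2_congruence)
  obtain U where U: "U \<in> GL2_congruence_subgroup F R"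
    "\<And>g. g \<in> carrier (Gal K) \<Longrightarrow> \<rho>' g = U \<otimes>\<^bsub>GL2 R\<^esub> \<rho> g \<otimes>\<^bsub>GL2 R\<^esub> inv\<^bsub>GL2 R\<^esub> U"
    using eq(1) unfolding strictly_equivalent_iff by blast
  obtain V where V: "V \<in> GL2_congruence_subgroup F R"
    "\<And>g. g \<in> carrier (Gal K) \<Longrightarrow> \<rho>'' g = V \<otimes>\<^bsub>GL2 R\<^esub> \<rho>' g \<otimes>\<^bsub>GL2 R\<^esub> inv\<^bsub>GL2 R\<^esub> V"
    using eq(2) unfolding strictly_equivalent_iff by blast
  show ?thesis
    unfolding strictly_equivalent_iff
  proof (intro bexI ballI)
    show "V \<otimes>\<^bsub>GL2 R\<^esub> U \<in> GL2_congruence_subgroup F R" using U(1) V(1) by simp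
    fix g assume g: "g \<in> carrier (Gal K)"
    then have "\<rho> g \<in> carrier (GL2 R)" by (rule funcset_mem[OF \<rho>])
    then show "\<rho>'' g = V \<otimes>\<^bsub>GL2 R\<^esub> U \<otimes>\<^bsub>GL2 R\<^esub> \<rho> g \<otimes>\<^bsub>GL2 R\<^esub> inv\<^bsub>GL2 R\<^esub> (V \<otimes>\<^bsub>GL2 R\<^esub> U)"
      unfolding V(2)[OF g] U(2)[OF g] using U(1) V(1)
      by (simp add: GL.inv_mult_group GL.m_assoc)
  qed
qed

lemma strictly_equivalent_tr2:
  assumes "\<rho> g \<in> carrier (GL2 R)" and "strictly_equivalent K F R \<rho> \<rho>'" and "g \<in> carrier (Gal K)"
  shows "tr2 R (\<rho>' g) = tr2 R (\<rho> g)"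
  using assms tr2_conjugate[OF _ assms(1)] unfolding strictly_equivalent_def by metis

end

context coefficient_ring_hom
begin

interpretation GL2: group_hom "GL2 R" "GL2 S" "map_mat2 f"
  by (rule map_mat2_GL2_group_hom[OF R.is_cring S.is_cring ring_hom])

lemma map_mat2_closed:
  "\<rho> \<in> carrier (Gal K) \<rightarrow> carrier (GL2 R) \<Longrightarrow>
    (\<lambda>g. map_mat2 f (\<rho> g)) \<in> carrier (Gal K) \<rightarrow> carrier (GL2 S)"
  by (simp add: Pi_iff)

lemma map_mat2_GL2_congruence:
  assumes "U \<in> GL2_congruence_subgroup F R"
  shows "map_mat2 f U \<in> GL2_congruence_subgroup F S"
proof (cases U)
  case (Mat2 a b c d)
  have U: "U \<in> carrier (GL2 R)" "map_mat2 (red R) U = \<one>\<^bsub>GL2 F\<^esub>"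
    using assms by (auto simp: GL2_congruence_subgroup_def kernel_def)
  then have "red R a = red R \<one>\<^bsub>R\<^esub>" "red R b = red R \<zero>\<^bsub>R\<^esub>" "red R c = red R \<zero>\<^bsub>R\<^esub>"
    "red R d = red R \<one>\<^bsub>R\<^esub>"
    by (simp_all add: Mat2 GL2_one)
  then have "red S (f a) = red S (f \<one>\<^bsub>R\<^esub>)" "red S (f b) = red S (f \<zero>\<^bsub>R\<^esub>)"
    "red S (f c) = red S (f \<zero>\<^bsub>R\<^esub>)" "red S (f d) = red S (f \<one>\<^bsub>R\<^esub>)"
    using U(1) by (simp_all only: red_image_eq_iff Mat2 Mat2_in_GL2_iff R.one_closed R.zero_closed)
  then have "map_mat2 (red S) (map_mat2 f U) = \<one>\<^bsub>GL2 F\<^esub>"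
    by (simp add: Mat2 GL2_one)
  then show ?thesis
    using U(1) by (simp add: GL2_congruence_subgroup_def kernel_def)
qed

lemma strictly_equivalent_map:
  assumes \<rho>: "\<rho> \<in> carrier (Gal K) \<rightarrow> carrier (GL2 R)" and eq: "strictly_equivalent K F R \<rho> \<rho>'"
  shows "strictly_equivalent K F S (\<lambda>g. map_mat2 f (\<rho> g)) (\<lambda>g. map_mat2 f (\<rho>' g))"
proof -
  obtain U where U: "U \<in> GL2_congruence_subgroup F R"
    "\<And>g. g \<in> carrier (Gal K) \<Longrightarrow> \<rho>' g = U \<otimes>\<^bsub>GL2 R\<^esub> \<rho> g \<otimes>\<^bsub>GL2 R\<^esub> inv\<^bsub>GL2 R\<^esub> U"
    using eq unfolding strictly_equivalent_iff by blast
  have "U \<in> carrier (GL2 R)"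
    using U(1) by (rule subgroup.mem_carrier[OF R.subgroup_GL2_congruence])
  then have "map_mat2 f (\<rho>' g) = map_mat2 f U \<otimes>\<^bsub>GL2 S\<^esub> map_mat2 f (\<rho> g) \<otimes>\<^bsub>GL2 S\<^esub>
      inv\<^bsub>GL2 S\<^esub> map_mat2 f U" if "g \<in> carrier (Gal K)" for g
    unfolding U(2)[OF that] using funcset_mem[OF \<rho> that] by simp
  then show ?thesis
    unfolding strictly_equivalent_iff using map_mat2_GL2_congruence[OF U(1)] by blast
qed

lemma strictly_equivalent_map_trans:
  assumes "\<rho> \<in> carrier (Gal K) \<rightarrow> carrier (GL2 R)" and "strictly_equivalent K F R \<rho> \<rho>'"
    and "strictly_equivalent K F S (\<lambda>g. map_mat2 f (\<rho>' g)) \<rho>''"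
  shows "strictly_equivalent K F S (\<lambda>g. map_mat2 f (\<rho> g)) \<rho>''"
  using map_mat2_closed[OF assms(1)] strictly_equivalent_map[OF assms(1,2)] assms(3)
  by (rule S.strictly_equivalent_trans)

end

lemma (in coefficient_ring) strictly_equivalent_funpow:
  assumes f: "f \<in> ring_hom R R" and \<rho>: "\<rho> \<in> carrier (Gal K) \<rightarrow> carrier (GL2 R)"
    and eq: "strictly_equivalent K F R (\<lambda>g. map_mat2 f (\<rho> g)) \<rho>"
  shows "strictly_equivalent K F R (\<lambda>g. map_mat2 (f ^^ n) (\<rho> g)) \<rho>"
proof (induction n)
  case 0
  show ?case using strictly_equivalent_refl[OF \<rho>] by (simp add: mat2.map_id[unfolded id_def])
next
  case (Suc n)
  interpret f: coefficient_ring_hom R R F p f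
    by (rule coefficient_ring_homI[OF coefficient_ring_axioms f])
  interpret fn: coefficient_ring_hom R R F p "f ^^ n"
    by (rule coefficient_ring_homI[OF coefficient_ring_axioms ring_hom_funpow[OF f]])
  from f.strictly_equivalent_map_trans[OF fn.map_mat2_closed[OF \<rho>] Suc eq]
  show ?case by (simp add: mat2.map_comp comp_def)
qed

section \<open>Universal deformations and Hecke algebras\<close>

lemma universal_deformation_closed:
  "universal_deformation p F K \<rho>bar P R \<rho> \<Longrightarrow> \<rho> \<in> carrier (Gal K) \<rightarrow> carrier (GL2 R)"
  by (rule deformation_closed[of K F \<rho>bar]) (simp add: universal_deformation_def)

lemma universal_deformation_residually_trivial_endo:
  assumes univ: "universal_deformation p F K \<rho>bar P R \<rho>"
    and R: "coefficient_ring R F p"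
    and f: "f \<in> ring_hom R R" "\<And>x. x \<in> carrier R \<Longrightarrow> red R (f x) = red R x"
    and eq: "strictly_equivalent K F R (\<lambda>g. map_mat2 f (\<rho> g)) \<rho>"
    and x: "x \<in> carrier R"
  shows "f x = x"
proof -
  interpret coefficient_ring R F p by fact
  note \<rho> = universal_deformation_closed[OF univ]
  have restrict_eq: "strictly_equivalent K F R (\<lambda>g. map_mat2 (restrict h (carrier R)) (\<rho> g)) \<rho> \<longleftrightarrow>
      strictly_equivalent K F R (\<lambda>g. map_mat2 h (\<rho> g)) \<rho>" for h
    by (intro strictly_equivalent_cong map_mat2_restrict funcset_mem[OF \<rho>])
  have "\<exists>!\<phi>. \<phi> \<in> calg_hom p F R R \<and> strictly_equivalent K F R (\<lambda>g. map_mat2 \<phi> (\<rho> g)) \<rho>"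
    using univ unfolding universal_deformation_def by blast
  moreover have "restrict f (carrier R) \<in> calg_hom p F R R"
    "restrict id (carrier R) \<in> calg_hom p F R R"
    using f id_ring_hom by (auto intro: residually_trivial_endo_calg_hom)
  moreover have "strictly_equivalent K F R (\<lambda>g. map_mat2 id (\<rho> g)) \<rho>"
    using strictly_equivalent_refl[OF \<rho>] by (simp add: mat2.map_id)
  ultimately have "restrict f (carrier R) = restrict id (carrier R)"
    using eq restrict_eq by blast
  from fun_cong[OF this, of x] show ?thesis using x by simp
qed

text \<open>
  The endomorphism need not be linear over \<open>W(F)\<close>, because \<open>F\<close> may be larger than the field
  generated by the traces of \<open>\<rho>bar\<close>; but some power of it is.
\<close>

lemma universal_deformation_endo_inj:
  assumes univ: "universal_deformation p F K \<rho>bar P R \<rho>"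
    and R: "coefficient_ring R F p"
    and f: "f \<in> ring_hom R R"
    and eq: "strictly_equivalent K F R (\<lambda>g. map_mat2 f (\<rho> g)) \<rho>"
  shows "inj_on f (carrier R)"
proof -
  interpret coefficient_ring R F p by fact
  obtain n where n: "n > 0" "\<And>x. x \<in> carrier R \<Longrightarrow> red R ((f ^^ n) x) = red R x"
    using endo_funpow_residually_trivial[OF f] by metis
  note \<rho> = universal_deformation_closed[OF univ]
  have id: "(f ^^ n) x = x" if "x \<in> carrier R" for x
    using univ R ring_hom_funpow[OF f] n(2) strictly_equivalent_funpow[OF f \<rho> eq] that
    by (rule universal_deformation_residually_trivial_endo)
  obtain m where "n = Suc m" using n(1) by (cases n) auto
  then have "f ^^ n = (f ^^ m) \<circ> f" by (simp add: funpow_Suc_right del: funpow.simps)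
  moreover have "inj_on (f ^^ n) (carrier R)" using id by (simp add: inj_on_def)
  ultimately show ?thesis by (metis inj_on_imageI2)
qed

lemma subring_eq_carrier_hecke_quotient:
  assumes \<pi>: "hecke_quotient_map p F j K k \<nn> T \<pi>" and B: "subring B T"
    and str: "\<And>w. w \<in> carrier (Witt p F) \<Longrightarrow> str T w \<in> B"
    and hecke: "\<And>\<qq>. \<qq> \<in> good_primes K p \<nn> \<Longrightarrow> \<pi> (hecke_op K k \<nn> \<qq>) \<in> B"
  shows "B = carrier T"
proof
  show "B \<subseteq> carrier T" using B by (rule subringE(1))
  have hom: "\<pi> \<in> ring_hom (hecke_algebra p F j K k \<nn>) T"
    and surj: "\<pi> ` hecke_carrier p F j K k \<nn> = carrier T"
    and \<pi>_scalar: "\<And>w. w \<in> carrier (Witt p F) \<Longrightarrow> \<pi> (scalar_op K k \<nn> (j w)) = str T w"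
    using \<pi> by (auto simp: hecke_quotient_map_def hecke_algebra_def)
  have "\<pi> A \<in> B" if "A \<in> hecke_carrier p F j K k \<nn>" for A
    using that
  proof induction
    case (scalar w)
    then show ?case using str \<pi>_scalar by metis
  next
    case (hecke \<qq>)
    then show ?case by (rule assms(4))
  next
    case (add A C)
    then show ?case
      using ring_hom_add[OF hom, of A C] subringE(7)[OF B] by (simp add: hecke_algebra_def)
  next
    case (mult A C)
    then show ?case
      using ring_hom_mult[OF hom, of A C] subringE(6)[OF B] by (simp add: hecke_algebra_def)
  qed
  then show "carrier T \<subseteq> B" using surj by (metis image_subsetI)
qed

lemma calg_hom_onto_hecke_quotient:
  assumes \<phi>: "\<phi> \<in> calg_hom p F R T" and R: "coefficient_ring R F p" and T: "coefficient_ring T F p"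
    and \<pi>: "hecke_quotient_map p F j K k \<nn> T \<pi>"
    and tr: "\<forall>\<qq>\<in>good_primes K p \<nn>.
      (\<lambda>\<sigma>. tr2 T (\<rho>' \<sigma>)) ` Frob K \<qq> = {\<pi> (hecke_op K k \<nn> \<qq>)}"
    and \<rho>: "\<rho> \<in> carrier (Gal K) \<rightarrow> carrier (GL2 R)"
    and eq: "strictly_equivalent K F T (\<lambda>g. map_mat2 \<phi> (\<rho> g)) \<rho>'"
  shows "\<phi> ` carrier R = carrier T"
proof (rule subring_eq_carrier_hecke_quotient[OF \<pi>])
  interpret R: coefficient_ring R F p by fact
  interpret T: coefficient_ring T F p by fact
  interpret \<phi>: coefficient_ring_hom R T F p \<phi>
    using R.coefficient_ring_homI[OF T] \<phi> by (simp add: calg_hom_def)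
  show "subring (\<phi> ` carrier R) T"
    by (rule \<phi>.img_is_subring[OF R.carrier_is_subring])
  show "str T w \<in> \<phi> ` carrier R" if w: "w \<in> carrier (Witt p F)" for w
  proof -
    have "\<phi> (str R w) = str T w" using \<phi> w unfolding calg_hom_def by blast
    then show ?thesis using ring_hom_closed[OF R.str_hom w] by (metis imageI)
  qed
  fix \<qq> assume "\<qq> \<in> good_primes K p \<nn>"
  then obtain \<sigma> where \<sigma>: "\<sigma> \<in> Frob K \<qq>" "tr2 T (\<rho>' \<sigma>) = \<pi> (hecke_op K k \<nn> \<qq>)"
    using tr by (metis (no_types, lifting) imageE insertI1)
  then have g: "\<sigma> \<in> carrier (Gal K)" and \<rho>\<sigma>: "\<rho> \<sigma> \<in> carrier (GL2 R)"
    using funcset_mem[OF \<rho>] by (auto simp: Frob_def)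
  have "\<pi> (hecke_op K k \<nn> \<qq>) = tr2 T (map_mat2 \<phi> (\<rho> \<sigma>))"
    using T.strictly_equivalent_tr2[OF funcset_mem[OF \<phi>.map_mat2_closed[OF \<rho>] g] eq g] \<sigma>(2)
    by simp
  also have "\<dots> = \<phi> (tr2 R (\<rho> \<sigma>))"
    by (rule tr2_map_mat2[OF \<phi>.ring_hom \<rho>\<sigma>])
  finally show "\<pi> (hecke_op K k \<nn> \<qq>) \<in> \<phi> ` carrier R"
    using R.tr2_closed[OF \<rho>\<sigma>] by blast
qed

theorem theorem4p3:
  fixes p :: nat and F :: "'a ring"
    and K L :: "complex set" and \<tau> :: "complex \<Rightarrow> complex"
    and chibar :: "(complex \<Rightarrow> complex) \<Rightarrow> 'a"
    and \<rho>bar :: "(complex \<Rightarrow> complex) \<Rightarrow> 'a mat2"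
    and j :: "(nat \<Rightarrow> 'a) \<Rightarrow> complex"
    and P :: "'a calg \<Rightarrow> ((complex \<Rightarrow> complex) \<Rightarrow> 'a mat2) \<Rightarrow> bool"
    and Runiv :: "'a calg" and \<rho>univ :: "(complex \<Rightarrow> complex) \<Rightarrow> 'a mat2"
    and chi :: "(complex \<Rightarrow> complex) \<Rightarrow> 'a"
    and \<nn> :: "complex set"
    and Tdih :: "'a calg" and \<pi> :: "(form \<Rightarrow> form) \<Rightarrow> 'a"
    and \<rho>dih :: "(complex \<Rightarrow> complex) \<Rightarrow> 'a mat2"
    and \<psi> :: "'a \<Rightarrow> 'a"
  assumes "Factorial_Ring.prime p"
    and "field F" and "finite (carrier F)" and "[p] \<cdot>\<^bsub>F\<^esub> \<one>\<^bsub>F\<^esub> = \<zero>\<^bsub>F\<^esub>"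
    and "number_field K" and "totally_real K"
    and "quadratic_extension K L"
    and "\<tau> \<in> carrier (Gal K) - carrier (Gal L)"
    and "galois_character L F (residue_calg F) chibar"
    and "\<rho>bar = induced_rep K L \<tau> (residue_calg F) chibar"
    and "absolutely_irreducible_rep (carrier (Gal K)) F \<rho>bar"
    and "totally_odd K F \<rho>bar"
    and "padic_identification p F j"
    and "deformation_property p F K \<rho>bar P"
    and "universal_deformation p F K \<rho>bar P Runiv \<rho>univ"
    and "galois_character L F Runiv chi"
    and "\<forall>g\<in>carrier (Gal L). red Runiv (chi g) = chibar g"
    and "strictly_equivalent K F Runiv (induced_rep K L \<tau> Runiv chi) \<rho>univ"
    and "unramified_above K p Runiv \<rho>univ"
    and "ideal \<nn> (Int_ring K)"
    and "\<nn> <+>\<^bsub>Int_ring K\<^esub> PIdl\<^bsub>Int_ring K\<^esub> (of_nat p) = carrier (Int_ring K)"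
    and "coeff_ring p F Tdih"
    and "hecke_quotient_map p F j K 1 \<nn> Tdih \<pi>"
    and "deformation K F \<rho>bar Tdih \<rho>dih"
    and "\<forall>\<qq>\<in>good_primes K p \<nn>.
           (\<lambda>\<sigma>. tr2 Tdih (\<rho>dih \<sigma>)) ` Frob K \<qq> = {\<pi> (hecke_op K 1 \<nn> \<qq>)}"
    and "\<psi> \<in> ring_hom Tdih Runiv"
    and "strictly_equivalent K F Runiv (\<lambda>g. map_mat2 \<psi> (\<rho>dih g)) \<rho>univ"
    and "P Tdih \<rho>dih"
  shows "calg_iso p F Runiv Tdih"
proof -
  interpret residue_field F p
    using assms(1-4) by (intro residue_field.intro residue_field_axioms.intro)
  note univ = \<open>universal_deformation p F K \<rho>bar P Runiv \<rho>univ\<close>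
  have R: "coefficient_ring Runiv F p" and T: "coefficient_ring Tdih F p"
    using univ \<open>coeff_ring p F Tdih\<close> by (auto simp: universal_deformation_def coefficient_ringI)
  obtain \<phi> where \<phi>: "\<phi> \<in> calg_hom p F Runiv Tdih"
    and \<phi>_\<rho>univ: "strictly_equivalent K F Tdih (\<lambda>g. map_mat2 \<phi> (\<rho>univ g)) \<rho>dih"
    using univ \<open>coeff_ring p F Tdih\<close> \<open>deformation K F \<rho>bar Tdih \<rho>dih\<close> \<open>P Tdih \<rho>dih\<close>
    unfolding universal_deformation_def by blast
  note \<rho>univ = universal_deformation_closed[OF univ]
  interpret \<phi>: coefficient_ring_hom Runiv Tdih F p \<phi>
    using R T \<phi> by (simp add: coefficient_ring.coefficient_ring_homI calg_hom_def)
  interpret \<psi>: coefficient_ring_hom Tdih Runiv F p \<psi>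
    using T R \<open>\<psi> \<in> ring_hom Tdih Runiv\<close> by (rule coefficient_ring.coefficient_ring_homI)
  have surj: "\<phi> ` carrier Runiv = carrier Tdih"
    using \<phi> R T assms(23,25) \<rho>univ \<phi>_\<rho>univ by (rule calg_hom_onto_hecke_quotient)
  have "strictly_equivalent K F Runiv (\<lambda>g. map_mat2 (\<psi> \<circ> \<phi>) (\<rho>univ g)) \<rho>univ"
    using \<psi>.strictly_equivalent_map_trans[OF \<phi>.map_mat2_closed[OF \<rho>univ] \<phi>_\<rho>univ assms(27)]
    by (simp add: mat2.map_comp)
  then have "inj_on (\<psi> \<circ> \<phi>) (carrier Runiv)"
    by (rule universal_deformation_endo_inj[OF univ R ring_hom_trans[OF \<phi>.ring_hom \<psi>.ring_hom]])
  then show ?thesis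
    using \<phi> surj inj_on_imageI2 unfolding calg_iso_def bij_betw_def by blast
qed

end
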